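(* Let $A = \{a_1,\dots,a_n\}$, let $t$ be a letter not in $A \cup A^{-1}$, and let $r_1,\dots,r_m, w_1,\dots,w_k \in (A\cup A^{-1})^*$. Let $G$ be the group $\mathrm{Gp}\langle A \mid r_1 = 1,\dots,r_m = 1\rangle$ and let $M$ be the inverse monoid $$\mathrm{Inv}\langle A, t \mid e r_1 = 1,\ r_2 = 1,\ \dots,\ r_m = 1\rangle,$$ where $e$ is the idempotent word $$e = e(a_1,\dots,a_n,\ tw_1t^{-1},\dots,tw_kt^{-1},\ a_1^{-1},\dots,a_n^{-1}).$$ Let $T$ be the submonoid of $G$ generated by $W = \{w_1,\dots,w_k\}$. Then $M$ is an $E$-unitary inverse monoid. Furthermore, if $M$ has decidable word problem, then the membership problem for $T$ within $G$ is decidable.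
   Context: $\mathrm{Gp}\langle A \mid R\rangle$ denotes the group defined by generators $A$ and defining relations $R$. For a set $Y$, $Y^*$ denotes the free monoid on $Y$. An inverse monoid is a monoid $M$ in which for every $m\in M$ there is a unique $m^{-1}\in M$ with $mm^{-1}m = m$ and $m^{-1}mm^{-1} = m^{-1}$. For a set $B$, let $B^{-1}$ be a disjoint set of formal inverses, and let $(x_1\cdots x_n)^{-1} = x_n^{-1}\cdots x_1^{-1}$ for words over $B\cup B^{-1}$, with $(b^{-1})^{-1}=b$. The inverse monoid $\mathrm{Inv}\langle B \mid u_i = v_i\ (i\in I)\rangle$, with $u_i,v_i\in (B\cup B^{-1})^*$, is $(B\cup B^{-1})^*/\sigma$, where $\sigma$ is the congruence generated by all pairs $(ww^{-1}w,w)$ and $(ww^{-1}uu^{-1},uu^{-1}ww^{-1})$ with $u,w\in (B\cup B^{-1})^*$, together with all pairs $(u_i,v_i)$. For words $u_1,\dots,u_l$, define $e(u_1,u_2,\dots,u_l) = u_1u_1^{-1}u_2u_2^{-1}\cdots u_lu_l^{-1}$. An idempotent word is a word that freely reduces to the empty word. For $M = \mathrm{Inv}\langle B\mid R\rangle$, the maximal group homomorphic image of $M$ is $K=\mathrm{Gp}\langle B\mid R\rangle$, with natural surjective homomorphism $\natural : M\to K$ sending the element represented by a word to the element of $K$ represented by the same word. $M$ is $E$-unitary if $\natural^{-1}(1_K) = E(M)$, where $E(M)$ is the set of idempotents of $M$. The submonoid of $G$ generated by a set of words means the submonoid generated by the elements of $G$ those words represent. The word problem for $M = \mathrm{Inv}\langle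 B\mid R\rangle$ with $B$ finite asks, given $u,v\in (B\cup B^{-1})^*$, whether they represent the same element of $M$. The membership problem for $T$ within $G$ asks, given $w\in (A\cup A^{-1})^*$, whether the element of $G$ represented by $w$ lies in $T$. A problem is decidable if there is an algorithm solving it. *)

theory Defs
  imports "HOL-Algebra.Group" "HOL-Library.Nat_Bijection"
begin

section \<open>Words over an involutive alphabet\<close>

datatype 'a letter = Pos 'a | Neg 'a

type_synonym 'a word = "'a letter list"

definition letters :: "'a set \<Rightarrow> 'a letter set" where
  "letters B = Pos ` B \<union> Neg ` B"

fun letter_inv :: "'a letter \<Rightarrow> 'a letter" where
  "letter_inv (Pos b) = Neg b"
| "letter_inv (Neg b) = Pos b"

definition word_inv :: "'a word \<Rightarrow> 'a word" where
  "word_inv w = rev (map letter_inv w)"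

definition idem_word :: "'a word list \<Rightarrow> 'a word" where
  "idem_word us = concat (map (\<lambda>u. u @ word_inv u) us)"


section \<open>Monoid, group and inverse monoid presentations\<close>

text \<open>The congruence on the free monoid over \<open>X\<close> generated by a set \<open>S\<close> of pairs of words.\<close>

inductive_set congruence :: "'x set \<Rightarrow> ('x list \<times> 'x list) set \<Rightarrow> ('x list \<times> 'x list) set"
  for X :: "'x set" and S :: "('x list \<times> 'x list) set" where
  gen: "\<lbrakk>(u, v) \<in> S; u \<in> lists X; v \<in> lists X\<rbrakk> \<Longrightarrow> (u, v) \<in> congruence X S"
| refl: "u \<in> lists X \<Longrightarrow> (u, u) \<in> congruence X S"
| sym: "(u, v) \<in> congruence X S \<Longrightarrow> (v, u) \<in> congruence X S"
| trans: "\<lbrakk>(u, v) \<in> congruence X S; (v, w) \<in> congruence X S\<rbrakk> \<Longrightarrow> (u, w) \<in> congruence X S"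
| mult: "\<lbrakk>(u, v) \<in> congruence X S; (u', v') \<in> congruence X S\<rbrakk>
    \<Longrightarrow> (u @ u', v @ v') \<in> congruence X S"

definition quotient_monoid :: "'x set \<Rightarrow> ('x list \<times> 'x list) set \<Rightarrow> 'x list set monoid" where
  "quotient_monoid X \<sigma> =
    \<lparr>carrier = lists X // \<sigma>,
     monoid.mult = (\<lambda>C D. \<Union>u\<in>C. \<Union>v\<in>D. \<sigma> `` {u @ v}),
     one = \<sigma> `` {[]}\<rparr>"

text \<open>A defining relation \<open>u = v\<close> is the pair \<open>(u, v)\<close>.\<close>

definition gp_cong :: "'a set \<Rightarrow> ('a word \<times> 'a word) set \<Rightarrow> ('a word \<times> 'a word) set" where
  "gp_cong B R = congruence (letters B) ({([x, letter_inv x], []) | x. x \<in> letters B} \<union> R)"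

definition Gp :: "'a set \<Rightarrow> ('a word \<times> 'a word) set \<Rightarrow> 'a word set monoid" where
  "Gp B R = quotient_monoid (letters B) (gp_cong B R)"

definition inv_cong :: "'a set \<Rightarrow> ('a word \<times> 'a word) set \<Rightarrow> ('a word \<times> 'a word) set" where
  "inv_cong B R = congruence (letters B)
    ({(w @ word_inv w @ w, w) | w. w \<in> lists (letters B)} \<union>
     {(w @ word_inv w @ u @ word_inv u, u @ word_inv u @ w @ word_inv w) | u w.
        u \<in> lists (letters B) \<and> w \<in> lists (letters B)} \<union> R)"

definition Inv :: "'a set \<Rightarrow> ('a word \<times> 'a word) set \<Rightarrow> 'a word set monoid" where
  "Inv B R = quotient_monoid (letters B) (inv_cong B R)"


section \<open>Inverse monoids and E-unitarity\<close>

definition inverse_monoid :: "('m, 'r) monoid_scheme \<Rightarrow> bool" where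
  "inverse_monoid M \<longleftrightarrow> monoid M \<and>
    (\<forall>m\<in>carrier M. \<exists>!m'. m' \<in> carrier M \<and>
       m \<otimes>\<^bsub>M\<^esub> m' \<otimes>\<^bsub>M\<^esub> m = m \<and> m' \<otimes>\<^bsub>M\<^esub> m \<otimes>\<^bsub>M\<^esub> m' = m')"

definition idempotents :: "('m, 'r) monoid_scheme \<Rightarrow> 'm set" where
  "idempotents M = {x \<in> carrier M. x \<otimes>\<^bsub>M\<^esub> x = x}"

text \<open>The natural homomorphism from \<open>Inv B R\<close> onto \<open>Gp B R\<close>. As \<open>inv_cong B R\<close> is contained in
  \<open>gp_cong B R\<close>, the image of the class of \<open>w\<close> is the class of \<open>w\<close> in the group.\<close>

definition natural_map :: "'a set \<Rightarrow> ('a word \<times> 'a word) set \<Rightarrow> 'a word set \<Rightarrow> 'a word set" where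
  "natural_map B R m = gp_cong B R `` m"

definition E_unitary :: "'a set \<Rightarrow> ('a word \<times> 'a word) set \<Rightarrow> bool" where
  "E_unitary B R \<longleftrightarrow>
    {m \<in> carrier (Inv B R). natural_map B R m = \<one>\<^bsub>Gp B R\<^esub>} = idempotents (Inv B R)"

definition generated_submonoid :: "('m, 'r) monoid_scheme \<Rightarrow> 'm set \<Rightarrow> 'm set" where
  "generated_submonoid G S = \<Inter>{H. submonoid H G \<and> S \<subseteq> H}"


section \<open>Decidability\<close>

text \<open>Partial recursive functions. Arities are not recorded: \<open>computes f xs y\<close> says that \<open>f\<close> is
  defined on the argument tuple \<open>xs\<close> with result \<open>y\<close>. In primitive recursion and minimisation the
  recursion (resp. search) variable is the first argument.\<close>

datatype recf =
    Zero
  | Succ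
  | Proj nat
  | Comp recf "recf list"
  | PrimRec recf recf
  | Mu recf

inductive computes :: "recf \<Rightarrow> nat list \<Rightarrow> nat \<Rightarrow> bool" where
  Zero: "computes Zero xs 0"
| Succ: "computes Succ [x] (Suc x)"
| Proj: "i < length xs \<Longrightarrow> computes (Proj i) xs (xs ! i)"
| Comp: "\<lbrakk>length ys = length gs; \<forall>i<length gs. computes (gs ! i) xs (ys ! i); computes f ys z\<rbrakk>
    \<Longrightarrow> computes (Comp f gs) xs z"
| PrimRec_0: "computes f xs y \<Longrightarrow> computes (PrimRec f g) (0 # xs) y"
| PrimRec_Suc: "\<lbrakk>computes (PrimRec f g) (n # xs) y; computes g (n # y # xs) z\<rbrakk>
    \<Longrightarrow> computes (PrimRec f g) (Suc n # xs) z"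
| Mu: "\<lbrakk>computes f (n # xs) 0; \<forall>i<n. \<exists>y. computes f (i # xs) (Suc y)\<rbrakk>
    \<Longrightarrow> computes (Mu f) xs n"

lemma computes_deterministic:
  "computes f xs y \<Longrightarrow> computes f xs z \<Longrightarrow> y = z"
proof (induction arbitrary: z rule: computes.induct)
  case (Zero xs)
  then show ?case by cases auto
next
  case (Succ x)
  then show ?case by cases auto
next
  case (Proj i xs)
  from Proj.prems show ?case by cases auto
next
  case (Comp ys gs xs f y)
  from Comp.prems obtain ys' where ys': "length ys' = length gs"
    "\<forall>i<length gs. computes (gs ! i) xs (ys' ! i)" "computes f ys' z"
    by cases blast
  have "ys = ys'"
    using Comp.hyps(1) Comp.IH(1) ys' by (intro nth_equalityI) auto
  with Comp.IH(2) ys'(3) show ?case by blast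
next
  case (PrimRec_0 f xs y g)
  from PrimRec_0.prems show ?case by cases (use PrimRec_0.IH in blast)
next
  case (PrimRec_Suc f g n xs y z')
  from PrimRec_Suc.prems show ?case by cases (use PrimRec_Suc.IH in blast)
next
  case (Mu f n xs)
  from Mu.prems have z: "computes f (z # xs) 0" "\<forall>i<z. \<exists>y. computes f (i # xs) (Suc y)"
    by (cases; blast)+
  have "\<not> z < n" using Mu.IH(2) z(1) by (metis nat.distinct(1))
  moreover have "\<not> n < z" using Mu.IH(1) z(2) by (metis nat.distinct(1))
  ultimately show ?case by simp
qed

text \<open>Decidability of a \<open>k\<close>-ary relation \<open>L\<close> between words over a finite alphabet \<open>X\<close>. Letters
  are coded by natural numbers and words by the usual coding of sequences; since \<open>X\<close> is finite, the
  choice of the code of the letters is immaterial. Only tuples of words over \<open>X\<close> are inputs.\<close>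

definition decidable_words :: "'x set \<Rightarrow> nat \<Rightarrow> 'x list list set \<Rightarrow> bool" where
  "decidable_words X k L \<longleftrightarrow> finite X \<and>
    (\<exists>code :: 'x \<Rightarrow> nat. inj_on code X \<and>
      (\<exists>f. \<forall>us. length us = k \<longrightarrow> set us \<subseteq> lists X \<longrightarrow>
        computes f (map (\<lambda>u. list_encode (map code u)) us) (if us \<in> L then 1 else 0)))"

definition decidable_word_problem :: "'a set \<Rightarrow> ('a word \<times> 'a word) set \<Rightarrow> bool" where
  "decidable_word_problem B R \<longleftrightarrow>
    decidable_words (letters B) 2 {[u, v] | u v. inv_cong B R `` {u} = inv_cong B R `` {v}}"

definition decidable_membership ::
    "'a set \<Rightarrow> ('a word \<times> 'a word) set \<Rightarrow> 'a word set set \<Rightarrow> bool" where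
  "decidable_membership A R T \<longleftrightarrow>
    decidable_words (letters A) 1 {[w] | w. gp_cong A R `` {w} \<in> T}"

end

theory Submission
  imports Defs "HOL-Library.Countable_Set"
begin

text \<open>
  The relation \<open>e r\<^sub>1 = 1\<close> makes the idempotent \<open>e\<close> right invertible. A right invertible idempotent
  is \<open>1\<close>, and a product of commuting idempotents is \<open>1\<close> only if each factor is. So \<open>M\<close> is the inverse
  monoid in which the letters of \<open>A\<close> are units that satisfy the relations of \<open>G\<close>, and in which every
  \<open>t w\<^sub>j t\<inverse>\<close> is right invertible. In particular \<open>G\<close> maps to \<open>M\<close> (\<open>gp_cong_cl\<^sub>M\<close>).

  The maximal group image is the free product of \<open>G\<close> and an infinite cyclic group generated by \<open>t\<close>.
  A word that is trivial there can be emptied by rewriting syllables in \<open>G\<close>, which does not change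
  its value in \<open>M\<close>, and by deleting inverse pairs \<open>t t\<inverse>\<close> and \<open>t\<inverse> t\<close>. Inverse pairs are idempotents,
  so a deletion goes up in the natural partial order, and no insertion is ever required. Hence the
  word lies below \<open>1\<close> in \<open>M\<close>, and the elements below \<open>1\<close> are the idempotents. The rewriting is carried
  out by a stack machine on reduced forms; its action factors through the group image
  (\<open>run_gp_cong\<close>), and each of its moves goes up in the natural order (\<open>step_below\<close>).

  Membership in \<open>T\<close> is decided by the equation \<open>t w t\<inverse> t = t w\<close> in \<open>M\<close>. If elements of \<open>M\<close> are
  pictured as partial injections, the equation says that \<open>w\<close> maps the range of \<open>t\<close> into itself. The
  words \<open>w\<^sub>j\<close> do, as \<open>t w\<^sub>j t\<inverse>\<close> is right invertible, and therefore all of \<open>T\<close> does (\<open>T_absorbs\<close>).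
  Conversely, \<open>M\<close> acts on countably many copies of \<open>G\<close>, with \<open>G\<close> acting by right multiplication and
  \<open>t\<close> as a bijection onto the copies of \<open>T\<close>; an element of \<open>G\<close> that maps \<open>T\<close> into itself lies in
  \<open>T\<close> (\<open>absorbs_imp_T\<close>). Since \<open>w\<close> enters the equation surrounded by fixed words, the passage from
  \<open>w\<close> to the equation is computable, and a decision procedure for \<open>M\<close> yields one for \<open>T\<close>.
\<close>

section \<open>Quotients of free monoids\<close>

text \<open>Membership of a word in \<open>lists X\<close> is kept whole, because classes are attached to words and
  not to their letters.\<close>

declare in_listsD [rule del] in_listsI [rule del]

lemma congruence_words:
  "(u, v) \<in> congruence X S \<Longrightarrow> u \<in> lists X \<and> v \<in> lists X"
  by (induction rule: congruence.induct) auto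

lemma class_eq_iff:
  "congruence X S `` {u} = congruence X S `` {v} \<longleftrightarrow>
    (u, v) \<in> congruence X S \<or> (u \<notin> lists X \<and> v \<notin> lists X)"
proof -
  have self: "w \<in> congruence X S `` {w} \<longleftrightarrow> w \<in> lists X" for w
    using congruence_words[of w w X S] congruence.refl[of w X S] by auto
  have empty: "congruence X S `` {w} = {}" if "w \<notin> lists X" for w
    using congruence_words[of w _ X S] that by auto
  have equal: "congruence X S `` {u} = congruence X S `` {v}" if "(u, v) \<in> congruence X S"
    using congruence.trans[OF that] congruence.trans[OF congruence.sym[OF that]] by auto
  have "(u, v) \<in> congruence X S" if "congruence X S `` {u} = congruence X S `` {v}" "v \<in> lists X"
    using that self[of v] by auto
  then show ?thesis
    using self[of u] self[of v] empty[of u] empty[of v] equal by blast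
qed

lemma class_eqI: "(u, v) \<in> congruence X S \<Longrightarrow> congruence X S `` {u} = congruence X S `` {v}"
  by (simp add: class_eq_iff)

text \<open>Words that are not over \<open>X\<close> have the empty class, which makes the law unconditional.\<close>

lemma class_append:
  assumes "congruence X S `` {u} = congruence X S `` {u'}"
    and "congruence X S `` {v} = congruence X S `` {v'}"
  shows "congruence X S `` {u @ v} = congruence X S `` {u' @ v'}"
proof (cases "u \<in> lists X \<and> v \<in> lists X")
  case True
  with assms show ?thesis
    by (intro class_eqI congruence.mult) (simp_all add: class_eq_iff)
next
  case False
  then have "u @ v \<notin> lists X" "u' @ v' \<notin> lists X"
    using assms congruence_words[of u u' X S] congruence_words[of v v' X S]
    by (auto simp: class_eq_iff)
  then show ?thesis by (simp add: class_eq_iff)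
qed

lemma quotient_one: "\<one>\<^bsub>quotient_monoid X \<sigma>\<^esub> = \<sigma> `` {[]}"
  by (simp add: quotient_monoid_def)

lemma quotient_carrier:
  "C \<in> carrier (quotient_monoid X \<sigma>) \<longleftrightarrow> (\<exists>u\<in>lists X. C = \<sigma> `` {u})"
  by (auto simp: quotient_monoid_def quotient_def)

lemma quotient_mult:
  assumes "u \<in> lists X" "v \<in> lists X"
  shows "(congruence X S `` {u}) \<otimes>\<^bsub>quotient_monoid X (congruence X S)\<^esub> (congruence X S `` {v}) =
    congruence X S `` {u @ v}" (is "?L = ?R")
proof -
  have "?L = (\<Union>u'\<in>congruence X S `` {u}. \<Union>v'\<in>congruence X S `` {v}. congruence X S `` {u' @ v'})"
    by (simp add: quotient_monoid_def)
  also have "\<dots> = (\<Union>u'\<in>congruence X S `` {u}. \<Union>v'\<in>congruence X S `` {v}. ?R)"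
  proof (intro SUP_cong HOL.refl)
    fix u' v' assume "u' \<in> congruence X S `` {u}" "v' \<in> congruence X S `` {v}"
    then show "congruence X S `` {u' @ v'} = ?R"
      by (intro class_eqI congruence.mult) (simp_all add: congruence.sym)
  qed
  also have "\<dots> = ?R"
    using assms congruence.refl[of _ X S] by blast
  finally show ?thesis .
qed

lemma monoid_quotient: "monoid (quotient_monoid X (congruence X S))"
proof (rule monoidI)
  let ?M = "quotient_monoid X (congruence X S)"
  fix C D E assume "C \<in> carrier ?M" "D \<in> carrier ?M" "E \<in> carrier ?M"
  then obtain u v w where "u \<in> lists X" "v \<in> lists X" "w \<in> lists X" "C = congruence X S `` {u}"
      "D = congruence X S `` {v}" "E = congruence X S `` {w}"
    unfolding quotient_carrier by blast
  then show "C \<otimes>\<^bsub>?M\<^esub> D \<in> carrier ?M" "C \<otimes>\<^bsub>?M\<^esub> D \<otimes>\<^bsub>?M\<^esub> E = C \<otimes>\<^bsub>?M\<^esub> (D \<otimes>\<^bsub>?M\<^esub> E)"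
      "\<one>\<^bsub>?M\<^esub> \<otimes>\<^bsub>?M\<^esub> C = C" "C \<otimes>\<^bsub>?M\<^esub> \<one>\<^bsub>?M\<^esub> = C"
    unfolding quotient_carrier by (simp_all add: quotient_one quotient_mult bexI[of _ "u @ v"])
qed (auto simp: quotient_carrier quotient_one)

text \<open>The universal property of the quotient, for a function on words that need not have values in a
  monoid. All three uses of a presentation below (mapping a group to \<open>M\<close>, \<open>M\<close> to a group, and either
  of them to transformations) are instances.\<close>

lemma congruence_respects:
  assumes "(u, v) \<in> congruence X S"
    and "\<And>u v. (u, v) \<in> S \<Longrightarrow> u \<in> lists X \<Longrightarrow> v \<in> lists X \<Longrightarrow> f u = f v"
    and "\<And>u u' v v'. \<lbrakk>u \<in> lists X; u' \<in> lists X; v \<in> lists X; v' \<in> lists X; f u = f u'; f v = f v'\<rbrakk>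
      \<Longrightarrow> f (u @ v) = f (u' @ v')"
  shows "f u = f v"
  using assms(1)
proof (induction rule: congruence.induct)
  case (gen u v)
  then show ?case by (rule assms(2))
next
  case (mult u v u' v')
  then show ?case
    using congruence_words[OF mult.hyps(1)] congruence_words[OF mult.hyps(2)]
    by (intro assms(3)) auto
qed auto


section \<open>Inverse words and presented groups\<close>

lemma letter_inv_inv [simp]: "letter_inv (letter_inv x) = x"
  by (cases x) auto

lemma letter_inv_letters [simp]: "letter_inv x \<in> letters B \<longleftrightarrow> x \<in> letters B"
  by (cases x) (auto simp: letters_def)

lemma word_inv_simps [simp]:
  "word_inv [] = []"
  "word_inv (x # w) = word_inv w @ [letter_inv x]"
  "word_inv (u @ v) = word_inv v @ word_inv u"
  "word_inv (word_inv w) = w"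
  by (auto simp: word_inv_def rev_map o_def)

lemma word_inv_lists [simp]: "word_inv w \<in> lists (letters B) \<longleftrightarrow> w \<in> lists (letters B)"
  by (induction w) auto

lemma idem_word_simps [simp]:
  "idem_word [] = []"
  "idem_word (u # us) = u @ word_inv u @ idem_word us"
  "idem_word (us @ vs) = idem_word us @ idem_word vs"
  by (auto simp: idem_word_def)

abbreviation gp_class :: "'a set \<Rightarrow> ('a word \<times> 'a word) set \<Rightarrow> 'a word \<Rightarrow> 'a word set" where
  "gp_class B R w \<equiv> gp_cong B R `` {w}"

abbreviation inv_class :: "'a set \<Rightarrow> ('a word \<times> 'a word) set \<Rightarrow> 'a word \<Rightarrow> 'a word set" where
  "inv_class B R w \<equiv> inv_cong B R `` {w}"

lemma gp_class_append:
  "gp_class B R u = gp_class B R u' \<Longrightarrow> gp_class B R v = gp_class B R v' \<Longrightarrow>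
    gp_class B R (u @ v) = gp_class B R (u' @ v')"
  unfolding gp_cong_def by (rule class_append)

lemma inv_class_append:
  "inv_class B R u = inv_class B R u' \<Longrightarrow> inv_class B R v = inv_class B R v' \<Longrightarrow>
    inv_class B R (u @ v) = inv_class B R (u' @ v')"
  unfolding inv_cong_def by (rule class_append)

lemma gp_class_inverse:
  assumes "w \<in> lists (letters B)"
  shows "gp_class B R (w @ word_inv w) = gp_class B R []"
  using assms
proof (induction w)
  case (Cons x w)
  have "gp_class B R ([x] @ (w @ word_inv w) @ [letter_inv x]) = gp_class B R ([x] @ [] @ [letter_inv x])"
    using Cons by (intro gp_class_append HOL.refl) auto
  also have "\<dots> = gp_class B R []"
    unfolding gp_cong_def using Cons by (auto intro!: class_eqI congruence.gen)
  finally show ?case by simp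
qed simp

lemma gp_class_relator:
  assumes "(u, v) \<in> R" "u \<in> lists (letters B)" "v \<in> lists (letters B)"
  shows "gp_class B R u = gp_class B R v"
  using assms unfolding gp_cong_def by (auto intro!: class_eqI congruence.gen)

lemma inv_class_relator:
  assumes "(u, v) \<in> R" "u \<in> lists (letters B)" "v \<in> lists (letters B)"
  shows "inv_class B R u = inv_class B R v"
  using assms unfolding inv_cong_def by (auto intro!: class_eqI congruence.gen)

lemma Gp_carrier: "C \<in> carrier (Gp B R) \<longleftrightarrow> (\<exists>u\<in>lists (letters B). C = gp_class B R u)"
  unfolding Gp_def by (rule quotient_carrier)

lemma gp_class_carrier: "u \<in> lists (letters B) \<Longrightarrow> gp_class B R u \<in> carrier (Gp B R)"
  unfolding Gp_carrier by blast

lemma Gp_one: "\<one>\<^bsub>Gp B R\<^esub> = gp_class B R []"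
  unfolding Gp_def by (rule quotient_one)

lemma Gp_mult:
  "u \<in> lists (letters B) \<Longrightarrow> v \<in> lists (letters B) \<Longrightarrow>
    gp_class B R u \<otimes>\<^bsub>Gp B R\<^esub> gp_class B R v = gp_class B R (u @ v)"
  unfolding Gp_def gp_cong_def by (rule quotient_mult)

lemma group_Gp: "group (Gp B R)"
proof (rule group.intro)
  show "monoid (Gp B R)"
    unfolding Gp_def gp_cong_def by (rule monoid_quotient)
  show "group_axioms (Gp B R)"
  proof
    show "carrier (Gp B R) \<subseteq> Units (Gp B R)"
    proof
      fix C assume "C \<in> carrier (Gp B R)"
      then obtain u where u: "u \<in> lists (letters B)" "C = gp_class B R u"
        unfolding Gp_carrier by blast
      then show "C \<in> Units (Gp B R)"
        using gp_class_inverse[of u B R] gp_class_inverse[of "word_inv u" B R]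
        by (simp add: Units_def gp_class_carrier Gp_one Gp_mult bexI[of _ "gp_class B R (word_inv u)"])
    qed
  qed
qed

lemma gp_class_cancel_left:
  assumes "gp_class B R (u @ v) = gp_class B R u" "u \<in> lists (letters B)" "v \<in> lists (letters B)"
  shows "gp_class B R v = gp_class B R []"
proof -
  interpret group "Gp B R" by (rule group_Gp)
  show ?thesis
    using assms l_cancel_one[of "gp_class B R u" "gp_class B R v"]
    by (simp add: Gp_mult Gp_one gp_class_carrier)
qed

lemma gp_cong_iff:
  "(v, u) \<in> gp_cong B R \<longleftrightarrow> v \<in> lists (letters B) \<and> gp_class B R u = gp_class B R v"
proof
  assume "(v, u) \<in> gp_cong B R"
  then have vu: "(v, u) \<in> congruence (letters B) ({([x, letter_inv x], []) | x. x \<in> letters B} \<union> R)"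
    by (simp add: gp_cong_def)
  show "v \<in> lists (letters B) \<and> gp_class B R u = gp_class B R v"
    using class_eqI[OF vu] congruence_words[OF vu] by (simp add: gp_cong_def)
next
  assume uv: "v \<in> lists (letters B) \<and> gp_class B R u = gp_class B R v"
  then have "v \<in> gp_class B R v" unfolding gp_cong_def by (simp add: congruence.refl)
  then have "v \<in> gp_class B R u" using uv by simp
  then show "(v, u) \<in> gp_cong B R" unfolding gp_cong_def by (simp add: congruence.sym)
qed


section \<open>Computing with the Wagner relations\<close>

text \<open>The function \<open>cls\<close> stands for the passage from words to their classes. Equations between
  classes can then be chained as equations of HOL.\<close>

locale wagner_quotient =
  fixes cls :: "'a word \<Rightarrow> 'c"
  assumes append: "cls u = cls u' \<Longrightarrow> cls v = cls v' \<Longrightarrow> cls (u @ v) = cls (u' @ v')"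
    and regular: "cls (w @ word_inv w @ w) = cls w"
    and commute: "cls (w @ word_inv w @ u @ word_inv u) = cls (u @ word_inv u @ w @ word_inv w)"
begin

lemma subst_word: "cls u = cls v \<Longrightarrow> cls (p @ u @ q) = cls (p @ v @ q)"
  by (intro append HOL.refl)

lemma subst_word_nil: "cls u = cls [] \<Longrightarrow> cls (p @ u @ q) = cls (p @ q)"
  using subst_word[of u "[]"] by simp

lemma idem_word_absorb:
  assumes "u \<in> set us"
  shows "cls (u @ word_inv u @ idem_word us) = cls (idem_word us)"
  using assms
proof (induction us)
  case (Cons v us)
  show ?case
  proof (cases "u = v")
    case True
    then show ?thesis
      using subst_word[OF regular[of u], of "[]" "word_inv u @ idem_word us"] by simp
  next
    case False
    then show ?thesis
      using Cons subst_word[OF commute[of u v], of "[]" "idem_word us"]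
        subst_word[OF Cons.IH, of "v @ word_inv v" "[]"] by simp
  qed
qed simp

lemma idem_word_absorb_all:
  assumes "set vs \<subseteq> set us"
  shows "cls (idem_word vs @ idem_word us) = cls (idem_word us)"
  using assms
proof (induction vs)
  case (Cons v vs)
  then show ?case
    using subst_word[of "idem_word vs @ idem_word us" "idem_word us" "v @ word_inv v" "[]"]
    by (simp add: idem_word_absorb)
qed simp

lemma idem_word_idempotent: "cls (idem_word us @ idem_word us) = cls (idem_word us)"
  by (rule idem_word_absorb_all) simp

text \<open>If \<open>f\<close> is idempotent and \<open>f r = 1\<close>, then \<open>f = f f r = f r = 1\<close>.\<close>

lemma idem_word_right_invertible:
  assumes "cls (idem_word us @ r) = cls []"
  shows "cls (idem_word us) = cls []"
proof -
  have "cls (idem_word us) = cls (idem_word us @ idem_word us @ r)"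
    using subst_word_nil[OF assms, of "idem_word us" "[]"] by simp
  also have "\<dots> = cls (idem_word us @ r)"
    using subst_word[OF idem_word_idempotent[of us], of "[]" r] by simp
  finally show ?thesis using assms by simp
qed

text \<open>The product absorbs each of its factors, so a factor of \<open>1\<close> is \<open>1\<close>.\<close>

lemma idem_word_trivial_factor:
  assumes "cls (idem_word us) = cls []" "u \<in> set us"
  shows "cls (u @ word_inv u) = cls []"
  using idem_word_absorb[OF assms(2)] subst_word_nil[OF assms(1), of "u @ word_inv u" "[]"] assms(1)
  by simp

text \<open>For an idempotent \<open>x\<close> with Wagner inverse \<open>y\<close>, the product \<open>y = (y x)(x y)\<close> is one of commuting
  idempotents; swapping them gives \<open>x y = y\<close>, and symmetrically \<open>y x = y\<close>.\<close>

lemma idempotent_self_inverse: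
  assumes "cls (x @ x) = cls x"
  shows "cls (x @ word_inv x) = cls x"
proof -
  define y where "y = word_inv x"
  have xyx: "cls (x @ y @ x) = cls x" and yxy: "cls (y @ x @ y) = cls y"
    and comm: "cls (x @ y @ y @ x) = cls (y @ x @ x @ y)"
    using regular[of x] regular[of y] commute[of x y] by (simp_all add: y_def)
  have y: "cls y = cls (x @ y @ y @ x)"
    using yxy subst_word[OF assms, of y y] comm by simp
  have "cls (x @ y) = cls (x @ x @ y @ y @ x)"
    using subst_word[OF y, of x "[]"] by simp
  also have "\<dots> = cls y"
    using subst_word[OF assms, of "[]" "y @ y @ x"] y by simp
  finally have xy: "cls (x @ y) = cls y" .
  have "cls (y @ x) = cls (x @ y @ y @ x @ x)"
    using subst_word[OF y, of "[]" x] by simp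
  also have "\<dots> = cls y"
    using subst_word[OF assms, of "x @ y @ y" "[]"] y by simp
  finally have yx: "cls (y @ x) = cls y" .
  have "cls x = cls (y @ x)"
    using xyx subst_word[OF xy, of "[]" x] by simp
  then show ?thesis using xy yx by (simp add: y_def)
qed

lemma idempotents_commute:
  assumes "cls (x @ x) = cls x" "cls (y @ y) = cls y"
  shows "cls (x @ y) = cls (y @ x)"
proof -
  note x = idempotent_self_inverse[OF assms(1)] and y = idempotent_self_inverse[OF assms(2)]
  show ?thesis
    using append[OF x y] append[OF y x] commute[of x y] by simp
qed

lemma inverse_unique:
  assumes wxw: "cls (w @ x @ w) = cls w" and xwx: "cls (x @ w @ x) = cls x"
  shows "cls x = cls (word_inv w)"
proof -
  define y where "y = word_inv w"
  have wyw: "cls (w @ y @ w) = cls w" and ywy: "cls (y @ w @ y) = cls y"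
    using regular[of w] regular[of y] by (simp_all add: y_def)
  have idem: "cls ((x @ w) @ (x @ w)) = cls (x @ w)" "cls ((w @ x) @ (w @ x)) = cls (w @ x)"
    "cls ((y @ w) @ (y @ w)) = cls (y @ w)" "cls ((w @ y) @ (w @ y)) = cls (w @ y)"
    using subst_word[OF wxw, of x "[]"] subst_word[OF wxw, of "[]" x]
      subst_word[OF wyw, of y "[]"] subst_word[OF wyw, of "[]" y] by simp_all
  \<comment> \<open>Both inverses equal the product \<open>y w x\<close>.\<close>
  have "cls x = cls (x @ w @ y @ w @ x)"
    using xwx subst_word[OF wyw, of x x] by simp
  also have "\<dots> = cls (y @ w @ x @ w @ x)"
    using subst_word[OF idempotents_commute[OF idem(1,3)], of "[]" x] by simp
  also have "\<dots> = cls (y @ w @ x)"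
    using subst_word[OF xwx, of "y @ w" "[]"] by simp
  finally have x: "cls x = cls (y @ w @ x)" .
  have "cls y = cls (y @ w @ x @ w @ y)"
    using ywy subst_word[OF wxw, of y y] by simp
  also have "\<dots> = cls (y @ w @ y @ w @ x)"
    using subst_word[OF idempotents_commute[OF idem(2,4)], of y "[]"] by simp
  also have "\<dots> = cls (y @ w @ x)"
    using subst_word[OF ywy, of "[]" "w @ x"] by simp
  finally show ?thesis using x by (simp add: y_def)
qed

text \<open>The natural partial order: \<open>u\<close> lies below \<open>v\<close> iff it is a restriction \<open>f v\<close> by an
  idempotent \<open>f\<close>. Writing \<open>f\<close> as an idempotent word makes transitivity a concatenation.\<close>

definition below :: "'a word \<Rightarrow> 'a word \<Rightarrow> bool" where
  "below u v \<longleftrightarrow> (\<exists>ds. cls u = cls (idem_word ds @ v))"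

lemma below_eq: "cls u = cls v \<Longrightarrow> below u v"
  unfolding below_def by (rule exI[of _ "[]"]) simp

lemma below_trans:
  assumes "below u v" "below v w"
  shows "below u w"
proof -
  obtain ds cs where "cls u = cls (idem_word ds @ v)" "cls v = cls (idem_word cs @ w)"
    using assms by (auto simp: below_def)
  then have "cls u = cls (idem_word (ds @ cs) @ w)"
    using subst_word[of v "idem_word cs @ w" "idem_word ds" "[]"] by simp
  then show ?thesis unfolding below_def by blast
qed

lemma below_append: "below u v \<Longrightarrow> below (u @ w) (v @ w)"
  unfolding below_def using subst_word[of u _ "[]" w] by fastforce

lemma below_delete_inverse_pair: "below (v @ x @ word_inv x) v"
proof -
  have "cls (v @ x @ word_inv x) = cls (v @ word_inv v @ v @ x @ word_inv x)"
    using subst_word[OF regular[of v], of "[]" "x @ word_inv x"] by simp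
  also have "\<dots> = cls (v @ x @ word_inv x @ word_inv v @ v)"
    using subst_word[OF commute[of x "word_inv v"], of v "[]"] by simp
  also have "\<dots> = cls (idem_word [v @ x] @ v)"
    by simp
  finally show ?thesis unfolding below_def by blast
qed

lemma below_empty_idempotent:
  assumes "below u []"
  shows "cls (u @ u) = cls u"
proof -
  obtain ds where ds: "cls u = cls (idem_word ds)"
    using assms by (auto simp: below_def)
  then show ?thesis
    using append[OF ds ds] idem_word_idempotent[of ds] by simp
qed

end

lemma wagner_inv_class: "wagner_quotient (inv_class B R)"
proof
  fix u w :: "'a word"
  show "inv_class B R (w @ word_inv w @ w) = inv_class B R w"
    by (cases "w \<in> lists (letters B)")
      (auto simp: inv_cong_def class_eq_iff intro!: congruence.gen)
  show "inv_class B R (w @ word_inv w @ u @ word_inv u) = inv_class B R (u @ word_inv u @ w @ word_inv w)"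
    by (cases "u \<in> lists (letters B) \<and> w \<in> lists (letters B)")
      (auto simp: inv_cong_def class_eq_iff intro!: congruence.gen)
qed (rule inv_class_append)

lemma Inv_carrier: "C \<in> carrier (Inv B R) \<longleftrightarrow> (\<exists>u\<in>lists (letters B). C = inv_class B R u)"
  unfolding Inv_def by (rule quotient_carrier)

lemma Inv_carrierE:
  assumes "C \<in> carrier (Inv B R)"
  obtains u where "u \<in> lists (letters B)" "C = inv_class B R u"
  using assms unfolding Inv_carrier by (elim bexE) (rule that)

lemma inv_class_carrier: "u \<in> lists (letters B) \<Longrightarrow> inv_class B R u \<in> carrier (Inv B R)"
  unfolding Inv_carrier by blast

lemma Inv_mult:
  "u \<in> lists (letters B) \<Longrightarrow> v \<in> lists (letters B) \<Longrightarrow>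
    inv_class B R u \<otimes>\<^bsub>Inv B R\<^esub> inv_class B R v = inv_class B R (u @ v)"
  unfolding Inv_def inv_cong_def by (rule quotient_mult)

lemma inverse_monoid_Inv: "inverse_monoid (Inv B R)"
proof -
  interpret wagner_quotient "inv_class B R" by (rule wagner_inv_class)
  have inverse: "\<exists>!m'. m' \<in> carrier (Inv B R) \<and> m \<otimes>\<^bsub>Inv B R\<^esub> m' \<otimes>\<^bsub>Inv B R\<^esub> m = m \<and>
      m' \<otimes>\<^bsub>Inv B R\<^esub> m \<otimes>\<^bsub>Inv B R\<^esub> m' = m'" if "m \<in> carrier (Inv B R)" for m
  proof -
    obtain w where w: "w \<in> lists (letters B)" "m = inv_class B R w"
      using \<open>m \<in> carrier (Inv B R)\<close> by (rule Inv_carrierE)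
    show ?thesis
    proof (rule ex1I[of _ "inv_class B R (word_inv w)"])
      show "inv_class B R (word_inv w) \<in> carrier (Inv B R) \<and>
          m \<otimes>\<^bsub>Inv B R\<^esub> inv_class B R (word_inv w) \<otimes>\<^bsub>Inv B R\<^esub> m = m \<and>
          inv_class B R (word_inv w) \<otimes>\<^bsub>Inv B R\<^esub> m \<otimes>\<^bsub>Inv B R\<^esub> inv_class B R (word_inv w)
            = inv_class B R (word_inv w)"
        using w regular[of w] regular[of "word_inv w"] by (simp add: inv_class_carrier Inv_mult)
    next
      fix m' assume m': "m' \<in> carrier (Inv B R) \<and> m \<otimes>\<^bsub>Inv B R\<^esub> m' \<otimes>\<^bsub>Inv B R\<^esub> m = m \<and>
        m' \<otimes>\<^bsub>Inv B R\<^esub> m \<otimes>\<^bsub>Inv B R\<^esub> m' = m'"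
      then have "m' \<in> carrier (Inv B R)" by simp
      then obtain x where x: "x \<in> lists (letters B)" "m' = inv_class B R x"
        by (rule Inv_carrierE)
      show "m' = inv_class B R (word_inv w)"
        using m' w x inverse_unique[of w x] by (simp add: Inv_mult)
    qed
  qed
  have "monoid (Inv B R)"
    unfolding Inv_def inv_cong_def by (rule monoid_quotient)
  then show ?thesis
    unfolding inverse_monoid_def by (intro conjI ballI inverse)
qed

text \<open>In a group every \<open>w w\<inverse>\<close> is trivial, so the Wagner relations hold there.\<close>

lemma inv_cong_gp_class:
  assumes "(u, v) \<in> inv_cong B R"
  shows "gp_class B R u = gp_class B R v"
  using assms unfolding inv_cong_def
proof (rule congruence_respects)
  fix u u' v v' :: "'a word"
  assume "gp_class B R u = gp_class B R u'" "gp_class B R v = gp_class B R v'"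
  then show "gp_class B R (u @ v) = gp_class B R (u' @ v')" by (rule gp_class_append)
next
  fix u v :: "'a word"
  assume uv: "u \<in> lists (letters B)" "v \<in> lists (letters B)"
    and "(u, v) \<in> {(w @ word_inv w @ w, w) | w. w \<in> lists (letters B)} \<union>
     {(w @ word_inv w @ u @ word_inv u, u @ word_inv u @ w @ word_inv w) | u w.
        u \<in> lists (letters B) \<and> w \<in> lists (letters B)} \<union> R"
  then consider "(u, v) \<in> R"
    | w where "u = w @ word_inv w @ w" "v = w" "w \<in> lists (letters B)"
    | x w where "u = w @ word_inv w @ x @ word_inv x" "v = x @ word_inv x @ w @ word_inv w"
      "x \<in> lists (letters B)" "w \<in> lists (letters B)"
    by blast
  then show "gp_class B R u = gp_class B R v"
  proof cases
    case 1
    with uv show ?thesis by (intro gp_class_relator)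
  next
    case 2
    then show ?thesis
      using gp_class_append[OF gp_class_inverse[of w B R] HOL.refl[of "gp_class B R w"]] by simp
  next
    case 3
    then show ?thesis
      using gp_class_append[OF gp_class_inverse[of w B R] gp_class_inverse[of x B R]]
        gp_class_append[OF gp_class_inverse[of x B R] gp_class_inverse[of w B R]] by simp
  qed
qed

lemma natural_map_class:
  assumes "w \<in> lists (letters B)"
  shows "natural_map B R (inv_class B R w) = gp_class B R w"
proof -
  have "gp_class B R u = gp_class B R w" if "u \<in> inv_class B R w" for u
    using that inv_cong_gp_class by blast
  moreover have "w \<in> inv_class B R w"
    using assms unfolding inv_cong_def by (simp add: congruence.refl)
  ultimately show ?thesis unfolding natural_map_def by blast
qed

lemma E_unitaryI:
  assumes "\<And>w. w \<in> lists (letters B) \<Longrightarrow> gp_class B R w = gp_class B R [] \<Longrightarrow>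
    inv_class B R (w @ w) = inv_class B R w"
  shows "E_unitary B R"
  unfolding E_unitary_def
proof (intro equalityI subsetI)
  fix m assume "m \<in> {m \<in> carrier (Inv B R). natural_map B R m = \<one>\<^bsub>Gp B R\<^esub>}"
  then have m: "m \<in> carrier (Inv B R)" "natural_map B R m = gp_class B R []"
    by (simp_all add: Gp_one)
  obtain w where "w \<in> lists (letters B)" "m = inv_class B R w"
    using m(1) by (rule Inv_carrierE)
  with m(2) have "w \<in> lists (letters B)" "m = inv_class B R w" "gp_class B R w = gp_class B R []"
    by (simp_all add: natural_map_class)
  then show "m \<in> idempotents (Inv B R)"
    using assms by (simp add: idempotents_def inv_class_carrier Inv_mult)
next
  fix m assume "m \<in> idempotents (Inv B R)"
  then have m: "m \<in> carrier (Inv B R)" "m \<otimes>\<^bsub>Inv B R\<^esub> m = m"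
    by (simp_all add: idempotents_def)
  obtain w where w: "w \<in> lists (letters B)" "m = inv_class B R w"
    using m(1) by (rule Inv_carrierE)
  with m(2) have ww: "inv_class B R (w @ w) = inv_class B R w"
    by (simp add: Inv_mult)
  from w ww have "gp_class B R (w @ w) = gp_class B R w"
    using natural_map_class[of "w @ w" B R] natural_map_class[of w B R] by simp
  then have "gp_class B R w = gp_class B R []"
    using w(1) w(1) by (rule gp_class_cancel_left)
  then show "m \<in> {m \<in> carrier (Inv B R). natural_map B R m = \<one>\<^bsub>Gp B R\<^esub>}"
    using w by (simp add: inv_class_carrier Gp_one natural_map_class)
qed

section \<open>Reduced forms in a free product with an infinite cyclic group\<close>

text \<open>A state \<open>(g, [(y\<^sub>l, g\<^sub>l), \<dots>, (y\<^sub>1, g\<^sub>1)])\<close> stands for the product \<open>g\<^sub>1 y\<^sub>1 g\<^sub>2 y\<^sub>2 \<cdots> g\<^sub>l y\<^sub>l g\<close>,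
  where \<open>y\<^sub>i\<close> is \<open>t\<close> or its inverse.\<close>

text \<open>Letters are multiplied from the right. A letter of \<open>A\<close> changes the current group element; an
  occurrence of \<open>t\<close> or its inverse pops the previous one if the two cancel, and is pushed otherwise. On the
  reduced states each letter acts as a permutation, inverse to that of its inverse letter
  (van der Waerden's argument for free products).\<close>

locale stack_machine = group G for G (structure) +
  fixes A :: "'b set" and t :: 'b and \<gamma> :: "'b letter \<Rightarrow> 'a"
  assumes t_notin: "t \<notin> A"
    and \<gamma>_closed: "x \<in> letters A \<Longrightarrow> \<gamma> x \<in> carrier G"
    and \<gamma>_inv: "x \<in> letters A \<Longrightarrow> \<gamma> (letter_inv x) = inv \<gamma> x"
begin

fun step :: "'a \<times> ('b letter \<times> 'a) list \<Rightarrow> 'b letter \<Rightarrow> 'a \<times> ('b letter \<times> 'a) list" where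
  "step (g, stk) x =
    (if x \<in> letters {t} then
       (if stk \<noteq> [] \<and> g = \<one> \<and> fst (hd stk) = letter_inv x then (snd (hd stk), tl stk)
        else (\<one>, (x, g) # stk))
     else (g \<otimes> \<gamma> x, stk))"

fun reduced :: "'a \<times> ('b letter \<times> 'a) list \<Rightarrow> bool" where
  "reduced (g, []) \<longleftrightarrow> g \<in> carrier G"
| "reduced (g, (y, h) # stk) \<longleftrightarrow> g \<in> carrier G \<and> y \<in> letters {t} \<and> reduced (h, stk) \<and>
    \<not> (stk \<noteq> [] \<and> h = \<one> \<and> fst (hd stk) = letter_inv y)"

abbreviation run where "run \<equiv> foldl step"

lemma letters_insert_cases:
  assumes "x \<in> letters (insert t A)"
  obtains "x \<in> letters {t}" | "x \<in> letters A" "x \<notin> letters {t}"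
  using assms t_notin by (auto simp: letters_def)

lemma reduced_carrier: "reduced (g, stk) \<Longrightarrow> g \<in> carrier G"
  by (cases "(g, stk)" rule: reduced.cases) auto

lemma reduced_change: "reduced (g, stk) \<Longrightarrow> g' \<in> carrier G \<Longrightarrow> reduced (g', stk)"
  by (cases "(g, stk)" rule: reduced.cases) auto

lemma reduced_step:
  assumes "reduced s" "x \<in> letters (insert t A)"
  shows "reduced (step s x)"
proof (cases s)
  case (Pair g stk)
  from assms(2) show ?thesis
  proof (cases rule: letters_insert_cases)
    case 1
    then show ?thesis using assms(1) Pair by (cases stk) auto
  next
    case 2
    then show ?thesis using assms(1) Pair \<gamma>_closed[of x] reduced_carrier[of g stk]
      by (auto intro: reduced_change)
  qed
qed

lemma reduced_run: "reduced s \<Longrightarrow> w \<in> lists (letters (insert t A)) \<Longrightarrow> reduced (run s w)"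
proof (induction w arbitrary: s)
  case (Cons x w)
  then show ?case using reduced_step[of s x] by (simp del: step.simps)
qed simp

text \<open>Reducedness is exactly what makes a pop the inverse of a push: the entry below a popped
  one cannot itself be popped by the same letter.\<close>

lemma step_letter_inv:
  assumes "reduced s" "x \<in> letters (insert t A)"
  shows "step (step s x) (letter_inv x) = s"
proof (cases s)
  case (Pair g stk)
  from assms(2) show ?thesis
  proof (cases rule: letters_insert_cases)
    case 1
    then have x: "letter_inv x \<in> letters {t}" by simp
    show ?thesis
    proof (cases "stk \<noteq> [] \<and> g = \<one> \<and> fst (hd stk) = letter_inv x")
      case True
      then obtain h stk' where stk: "stk = (letter_inv x, h) # stk'"
        by (cases stk) auto
      then show ?thesis
        using assms(1) Pair True 1 x by auto
    next
      case False
      then show ?thesis using Pair 1 x by auto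
    qed
  next
    case 2
    then have "letter_inv x \<notin> letters {t}" by simp
    then show ?thesis
      using 2 Pair assms(1) reduced_carrier[of g stk] \<gamma>_closed[of x] \<gamma>_inv[of x]
      by (simp add: m_assoc)
  qed
qed

lemma run_word_inv:
  assumes "reduced s" "w \<in> lists (letters (insert t A))"
  shows "run s (w @ word_inv w) = s"
  using assms
proof (induction w arbitrary: s)
  case (Cons x w)
  then have "run (step s x) (w @ word_inv w) = step s x"
    by (intro Cons.IH reduced_step) auto
  then show ?case
    using Cons.prems step_letter_inv[of s x] by (simp del: step.simps)
qed simp

lemma run_idem_word:
  assumes "reduced s" "set us \<subseteq> lists (letters (insert t A))"
  shows "run s (idem_word us) = s"
  using assms
proof (induction us)
  case (Cons u us)
  have "run s (idem_word (u # us)) = run (run s (u @ word_inv u)) (idem_word us)"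
    by simp
  also have "\<dots> = s"
    using Cons by (subst run_word_inv) auto
  finally show ?case .
qed simp

end


section \<open>Inverse monoids of partial injections\<close>

text \<open>The relations \<open>\<rho> x\<close> are partial injections of \<open>X\<close>, applied from left to right. The empty word
  acts as the identity of \<open>X\<close> rather than of the whole type, so that a total injection \<open>f\<close>
  satisfies \<open>f f\<inverse> = 1\<close>.\<close>

locale partial_injections =
  fixes X :: "'x set" and \<rho> :: "'a letter \<Rightarrow> ('x \<times> 'x) set"
  assumes \<rho>_subset: "\<rho> x \<subseteq> X \<times> X"
    and \<rho>_single_valued: "single_valued (\<rho> x)"
    and \<rho>_letter_inv: "\<rho> (letter_inv x) = (\<rho> x)\<inverse>"
begin

fun act :: "'a word \<Rightarrow> ('x \<times> 'x) set" where
  "act [] = Id_on X"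
| "act (x # w) = \<rho> x O act w"

lemma act_subset: "act w \<subseteq> X \<times> X"
  by (induction w) (use \<rho>_subset in auto)

lemma act_append: "act (u @ v) = act u O act v"
proof (induction u)
  case Nil
  then show ?case using act_subset[of v] by auto
next
  case (Cons x u)
  then show ?case by (simp add: O_assoc)
qed

lemma act_single: "act [x] = \<rho> x"
  using \<rho>_subset[of x] by auto

lemma act_word_inv: "act (word_inv w) = (act w)\<inverse>"
proof (induction w)
  case (Cons x w)
  then show ?case by (simp add: act_append act_single \<rho>_letter_inv converse_relcomp del: act.simps(2))
    (simp add: converse_relcomp)
qed auto

lemma single_valued_act: "single_valued (act w)"
  by (induction w) (auto intro: single_valued_relcomp \<rho>_single_valued)

lemma act_inverse: "act (w @ word_inv w) = Id_on (Domain (act w))"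
proof -
  have "single_valued ((act w)\<inverse>)"
    using single_valued_act[of "word_inv w"] by (simp add: act_word_inv)
  then show ?thesis
    unfolding act_append act_word_inv by (fastforce dest: single_valuedD)
qed

lemma act_inverse_total: "Domain (act w) = X \<Longrightarrow> act (w @ word_inv w) = Id_on X"
  by (simp add: act_inverse)

lemma act_idem_word:
  assumes "\<And>u. u \<in> set us \<Longrightarrow> Domain (act u) = X"
  shows "act (idem_word us) = Id_on X"
  using assms
proof (induction us)
  case (Cons u us)
  have "act (idem_word (u # us)) = act (u @ word_inv u) O act (idem_word us)"
    by (simp add: act_append O_assoc)
  also have "\<dots> = Id_on X"
    using Cons by (auto simp: act_inverse_total)
  finally show ?case .
qed simp

text \<open>Both \<open>f f\<inverse> f = f\<close> and the commutation of \<open>f f\<inverse>\<close> with \<open>g g\<inverse>\<close> hold because \<open>f f\<inverse>\<close> is the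
  partial identity on the domain of \<open>f\<close>.\<close>

lemma inv_cong_act:
  assumes "(u, v) \<in> inv_cong B R" and R: "\<And>u v. (u, v) \<in> R \<Longrightarrow> act u = act v"
  shows "act u = act v"
  using assms(1) unfolding inv_cong_def
proof (rule congruence_respects)
  fix u u' v v' :: "'a word"
  assume "act u = act u'" "act v = act v'"
  then show "act (u @ v) = act (u' @ v')" by (simp add: act_append)
next
  fix u v :: "'a word"
  assume "(u, v) \<in> {(w @ word_inv w @ w, w) | w. w \<in> lists (letters B)} \<union>
     {(w @ word_inv w @ u @ word_inv u, u @ word_inv u @ w @ word_inv w) | u w.
        u \<in> lists (letters B) \<and> w \<in> lists (letters B)} \<union> R"
  then consider "(u, v) \<in> R"
    | w where "u = (w @ word_inv w) @ w" "v = w"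
    | x w where "u = (w @ word_inv w) @ x @ word_inv x" "v = (x @ word_inv x) @ w @ word_inv w"
    by auto
  then show "act u = act v"
  proof cases
    case 1
    then show ?thesis by (rule R)
  next
    case 2
    then have "act u = Id_on (Domain (act w)) O act w"
      using act_append[of "w @ word_inv w" w] act_inverse[of w] by simp
    with 2 show ?thesis by auto
  next
    case 3
    then have "act u = Id_on (Domain (act w)) O Id_on (Domain (act x))"
        "act v = Id_on (Domain (act x)) O Id_on (Domain (act w))"
      using act_append[of "w @ word_inv w" "x @ word_inv x"] act_append[of "x @ word_inv x" "w @ word_inv w"]
        act_inverse[of w] act_inverse[of x] by simp_all
    then show ?thesis by auto
  qed
qed

end


section \<open>Generated submonoids\<close>

lemma submonoid_generated:
  assumes "monoid G" "S \<subseteq> carrier G"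
  shows "submonoid (generated_submonoid G S) G"
proof
  interpret monoid G by fact
  have "submonoid (carrier G) G" by unfold_locales auto
  then show "generated_submonoid G S \<subseteq> carrier G"
    using assms(2) by (auto simp: generated_submonoid_def)
  show "\<one>\<^bsub>G\<^esub> \<in> generated_submonoid G S"
    by (auto simp: generated_submonoid_def submonoid.one_closed)
  show "x \<otimes>\<^bsub>G\<^esub> y \<in> generated_submonoid G S"
    if "x \<in> generated_submonoid G S" "y \<in> generated_submonoid G S" for x y
    using that unfolding generated_submonoid_def by (blast intro: submonoid.m_closed)
qed

lemma generated_submonoid_incl: "S \<subseteq> generated_submonoid G S"
  by (auto simp: generated_submonoid_def)

lemma generated_submonoid_least: "submonoid H G \<Longrightarrow> S \<subseteq> H \<Longrightarrow> generated_submonoid G S \<subseteq> H"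
  by (auto simp: generated_submonoid_def)

section \<open>Recursive functions on codes of words\<close>

definition recursive :: "nat \<Rightarrow> (nat list \<Rightarrow> nat) \<Rightarrow> bool" where
  "recursive k F \<longleftrightarrow> (\<exists>f. \<forall>xs. length xs = k \<longrightarrow> computes f xs (F xs))"

lemma recursive_cong:
  "recursive k F \<Longrightarrow> (\<And>xs. length xs = k \<Longrightarrow> F xs = G xs) \<Longrightarrow> recursive k G"
  unfolding recursive_def by metis

lemma recursive_comp:
  assumes H: "recursive (length Fs) H" and Fs: "\<forall>F\<in>set Fs. recursive k F"
  shows "recursive k (\<lambda>xs. H (map (\<lambda>F. F xs) Fs))"
proof -
  obtain h where h: "computes h xs (H xs)" if "length xs = length Fs" for xs
    using H by (auto simp: recursive_def)
  obtain c where c: "computes (c F) xs (F xs)" if "F \<in> set Fs" "length xs = k" for F xs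
    using Fs unfolding recursive_def by metis
  have "computes (Comp h (map c Fs)) xs (H (map (\<lambda>F. F xs) Fs))" if "length xs = k" for xs
    by (rule computes.Comp[of "map (\<lambda>F. F xs) Fs"]) (use that c h in auto)
  then show ?thesis unfolding recursive_def by blast
qed

lemma recursive_comp1:
  "recursive 1 (\<lambda>xs. h (xs ! 0)) \<Longrightarrow> recursive k F \<Longrightarrow> recursive k (\<lambda>xs. h (F xs))"
  using recursive_comp[of "[F]" "\<lambda>xs. h (xs ! 0)" k] by simp

lemma recursive_comp3:
  "recursive 3 (\<lambda>xs. h (xs ! 0) (xs ! 1) (xs ! 2)) \<Longrightarrow> recursive k F \<Longrightarrow> recursive k G \<Longrightarrow>
    recursive k H \<Longrightarrow> recursive k (\<lambda>xs. h (F xs) (G xs) (H xs))"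
  using recursive_comp[of "[F, G, H]" "\<lambda>xs. h (xs ! 0) (xs ! 1) (xs ! 2)" k]
  by (simp add: numeral_2_eq_2 numeral_3_eq_3)

lemma recursive_proj: "i < k \<Longrightarrow> recursive k (\<lambda>xs. xs ! i)"
  unfolding recursive_def using computes.Proj by blast

lemma recursive_Suc:
  assumes "recursive k F"
  shows "recursive k (\<lambda>xs. Suc (F xs))"
proof (rule recursive_comp1[OF _ assms])
  have "computes Succ xs (Suc (xs ! 0))" if "length xs = 1" for xs
    using that computes.Succ by (auto simp: length_Suc_conv)
  then show "recursive 1 (\<lambda>xs. Suc (xs ! 0))" unfolding recursive_def by blast
qed

lemma recursive_const: "recursive k (\<lambda>_. c)"
proof (induction c)
  case 0
  show ?case unfolding recursive_def using computes.Zero by blast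
qed (rule recursive_Suc)

lemma recursive_primrec:
  assumes F: "recursive k F" and G: "recursive (Suc (Suc k)) G"
  shows "recursive (Suc k) (\<lambda>xs. rec_nat (F (tl xs)) (\<lambda>n y. G (n # y # tl xs)) (hd xs))"
proof -
  obtain f where f: "computes f xs (F xs)" if "length xs = k" for xs
    using F by (auto simp: recursive_def)
  obtain g where g: "computes g xs (G xs)" if "length xs = Suc (Suc k)" for xs
    using G by (auto simp: recursive_def)
  have "computes (PrimRec f g) (n # xs) (rec_nat (F xs) (\<lambda>n y. G (n # y # xs)) n)"
    if "length xs = k" for n xs
    using that by (induction n) (auto intro!: computes.PrimRec_0 computes.PrimRec_Suc f g)
  then have "computes (PrimRec f g) xs (rec_nat (F (tl xs)) (\<lambda>n y. G (n # y # tl xs)) (hd xs))"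
    if "length xs = Suc k" for xs
    using that by (cases xs) auto
  then show ?thesis unfolding recursive_def by blast
qed

text \<open>All recursions below run over a computed argument and carry at most two parameters; this form
  hides the bookkeeping with argument tuples.\<close>

lemma recursive_rec:
  assumes "recursive 2 (\<lambda>xs. a (xs ! 0) (xs ! 1))"
    and "recursive 4 (\<lambda>xs. g (xs ! 0) (xs ! 1) (xs ! 2) (xs ! 3))"
    and "recursive k N" "recursive k P" "recursive k Q"
  shows "recursive k (\<lambda>xs. rec_nat (a (P xs) (Q xs)) (\<lambda>n y. g n y (P xs) (Q xs)) (N xs))"
proof (rule recursive_comp3[OF _ assms(3-5)])
  have "recursive (Suc 2) (\<lambda>xs. rec_nat (a (tl xs ! 0) (tl xs ! 1))
      (\<lambda>n y. g ((n # y # tl xs) ! 0) ((n # y # tl xs) ! 1) ((n # y # tl xs) ! 2) ((n # y # tl xs) ! 3)) (hd xs))"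
    using assms(2) by (intro recursive_primrec assms(1)) (simp add: numeral_eq_Suc)
  then have "recursive 3 (\<lambda>xs. rec_nat (a (tl xs ! 0) (tl xs ! 1))
      (\<lambda>n y. g n y (tl xs ! 0) (tl xs ! 1)) (hd xs))"
    by (simp add: numeral_eq_Suc)
  then show "recursive 3 (\<lambda>xs. rec_nat (a (xs ! 1) (xs ! 2)) (\<lambda>n y. g n y (xs ! 1) (xs ! 2)) (xs ! 0))"
    by (rule recursive_cong) (auto simp: length_Suc_conv numeral_eq_Suc)
qed

text \<open>Minimisation demands that all values before the first zero are defined. They are, because
  \<open>F\<close> is total on the tuples of its arity.\<close>

lemma recursive_Least:
  assumes F: "recursive (Suc k) F" and ex: "\<And>xs. length xs = k \<Longrightarrow> \<exists>n. F (n # xs) = 0"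
  shows "recursive k (\<lambda>xs. LEAST n. F (n # xs) = 0)"
proof -
  obtain f where f: "computes f xs (F xs)" if "length xs = Suc k" for xs
    using F by (auto simp: recursive_def)
  have "computes (Mu f) xs (LEAST n. F (n # xs) = 0)" if len: "length xs = k" for xs
  proof (rule computes.Mu)
    have "F ((LEAST n. F (n # xs) = 0) # xs) = 0"
      using ex[OF len] by (rule LeastI_ex)
    then show "computes f ((LEAST n. F (n # xs) = 0) # xs) 0"
      using f[of "(LEAST n. F (n # xs) = 0) # xs"] len by simp
    show "\<forall>i<LEAST n. F (n # xs) = 0. \<exists>y. computes f (i # xs) (Suc y)"
    proof (intro allI impI)
      fix i assume "i < (LEAST n. F (n # xs) = 0)"
      then have "F (i # xs) \<noteq> 0" using not_less_Least by blast
      then obtain y where "F (i # xs) = Suc y" using not0_implies_Suc by blast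
      then show "\<exists>y. computes f (i # xs) (Suc y)"
        using f[of "i # xs"] len by auto
    qed
  qed
  then show ?thesis unfolding recursive_def by blast
qed

lemma recursive_pred:
  assumes "recursive k F"
  shows "recursive k (\<lambda>xs. F xs - 1)"
proof -
  have "recursive k (\<lambda>xs. rec_nat 0 (\<lambda>n y. n) (F xs))"
    using recursive_rec[of "\<lambda>_ _. 0" "\<lambda>n _ _ _. n", OF _ _ assms recursive_const recursive_const]
    by (simp add: recursive_const recursive_proj)
  moreover have "rec_nat 0 (\<lambda>n y. n) m = m - 1" for m :: nat by (cases m) auto
  ultimately show ?thesis by simp
qed

lemma recursive_add:
  assumes "recursive k F" "recursive k G"
  shows "recursive k (\<lambda>xs. F xs + G xs)"
proof -
  have "recursive k (\<lambda>xs. rec_nat (F xs) (\<lambda>n y. Suc y) (G xs))"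
    using recursive_rec[of "\<lambda>a _. a" "\<lambda>_ y _ _. Suc y", OF _ _ assms(2,1) recursive_const]
    by (simp add: recursive_Suc recursive_proj)
  moreover have "rec_nat m (\<lambda>n y. Suc y) n = m + n" for m n :: nat by (induction n) auto
  ultimately show ?thesis by simp
qed

lemma recursive_diff:
  assumes "recursive k F" "recursive k G"
  shows "recursive k (\<lambda>xs. F xs - G xs)"
proof -
  have "recursive k (\<lambda>xs. rec_nat (F xs) (\<lambda>n y. y - 1) (G xs))"
    using recursive_rec[of "\<lambda>a _. a" "\<lambda>_ y _ _. y - 1", OF _ _ assms(2,1) recursive_const]
      recursive_pred[OF recursive_proj, of 1 4]
    by (simp add: recursive_proj)
  moreover have "rec_nat m (\<lambda>n y. y - 1) n = m - n" for m n :: nat by (induction n) auto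
  ultimately show ?thesis by simp
qed

lemma recursive_if:
  assumes "recursive k F" "recursive k G" "recursive k H"
  shows "recursive k (\<lambda>xs. if F xs = 0 then G xs else H xs)"
proof -
  have "recursive k (\<lambda>xs. rec_nat (G xs) (\<lambda>n y. H xs) (F xs))"
    using recursive_rec[of "\<lambda>a _. a" "\<lambda>_ _ _ b. b", OF _ _ assms]
    by (simp add: recursive_proj)
  moreover have "rec_nat a (\<lambda>n y. b) m = (if m = 0 then a else b)" for a b m :: nat by (cases m) auto
  ultimately show ?thesis by simp
qed

lemma recursive_triangle:
  assumes "recursive k F"
  shows "recursive k (\<lambda>xs. triangle (F xs))"
proof -
  have "recursive k (\<lambda>xs. rec_nat 0 (\<lambda>n y. y + Suc n) (F xs))"
    using recursive_rec[of "\<lambda>_ _. 0" "\<lambda>n y _ _. y + Suc n", OF _ _ assms recursive_const recursive_const]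
    by (simp add: recursive_const recursive_add recursive_Suc recursive_proj del: add_Suc_right)
  moreover have "rec_nat 0 (\<lambda>n y. y + Suc n) m = triangle m" for m by (induction m) auto
  ultimately show ?thesis by simp
qed

text \<open>The Cantor pairing enumerates the diagonals \<open>m + n = s\<close> one after the other, and the
  \<open>s\<close>-th one ends just before \<open>triangle (s + 1)\<close>. The diagonal of a code is thus found by
  unbounded search, and it determines both components.\<close>

definition diagonal :: "nat \<Rightarrow> nat" where
  "diagonal p = (LEAST s. Suc p - triangle (Suc s) = 0)"

lemma diagonal_prod_encode: "diagonal (prod_encode (m, n)) = m + n"
  unfolding diagonal_def
proof (rule Least_equality)
  show "Suc (prod_encode (m, n)) - triangle (Suc (m + n)) = 0"
    by (simp add: prod_encode_def)
next
  fix s assume s: "Suc (prod_encode (m, n)) - triangle (Suc s) = 0"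
  have mono: "mono triangle" by (simp add: mono_iff_le_Suc)
  show "m + n \<le> s"
  proof (rule ccontr)
    assume "\<not> m + n \<le> s"
    then have "triangle (Suc s) \<le> triangle (m + n)" by (intro monoD[OF mono]) simp
    with s show False by (simp add: prod_encode_def)
  qed
qed

lemma recursive_diagonal:
  assumes "recursive k F"
  shows "recursive k (\<lambda>xs. diagonal (F xs))"
proof (rule recursive_comp1[OF _ assms])
  have "recursive 1 (\<lambda>xs. LEAST s. Suc ((s # xs) ! 1) - triangle (Suc ((s # xs) ! 0)) = 0)"
  proof (rule recursive_Least)
    show "recursive (Suc 1) (\<lambda>xs. Suc (xs ! 1) - triangle (Suc (xs ! 0)))"
      by (intro recursive_diff recursive_triangle recursive_Suc recursive_proj) auto
    fix xs :: "nat list"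
    have "Suc ((xs ! 0)) - triangle (Suc (xs ! 0)) = 0" by simp
    then show "\<exists>s. Suc ((s # xs) ! 1) - triangle (Suc ((s # xs) ! 0)) = 0"
      by (intro exI[of _ "xs ! 0"]) simp
  qed
  then show "recursive 1 (\<lambda>xs. diagonal (xs ! 0))"
    by (simp add: diagonal_def)
qed

lemma prod_decode_diagonal:
  "fst (prod_decode p) = p - triangle (diagonal p)"
  "snd (prod_decode p) = diagonal p - (p - triangle (diagonal p))"
proof -
  obtain m n where "prod_decode p = (m, n)" by fastforce
  moreover from this have "p = prod_encode (m, n)" by (metis prod_decode_inverse)
  ultimately show "fst (prod_decode p) = p - triangle (diagonal p)"
    "snd (prod_decode p) = diagonal p - (p - triangle (diagonal p))"
    using diagonal_prod_encode[of m n] by (simp_all add: prod_encode_def)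
qed

lemma recursive_pairing:
  assumes "recursive k F"
  shows "recursive k (\<lambda>xs. fst (prod_decode (F xs)))" "recursive k (\<lambda>xs. snd (prod_decode (F xs)))"
  unfolding prod_decode_diagonal
  by (intro recursive_diff recursive_triangle recursive_diagonal assms)+

lemma recursive_Cons:
  assumes "recursive k F" "recursive k G"
  shows "recursive k (\<lambda>xs. list_encode (F xs # list_decode (G xs)))"
  using assms unfolding list_encode.simps list_decode_inverse prod_encode_def prod.case
  by (intro recursive_Suc recursive_add recursive_triangle)

lemma list_encode_eq_0: "list_encode xs = 0 \<longleftrightarrow> xs = []"
  by (cases xs) auto

lemma recursive_hd:
  assumes "recursive k F"
  shows "recursive k (\<lambda>xs. fst (prod_decode (F xs - 1)))"
  by (intro recursive_pairing recursive_pred assms)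

lemma hd_list_decode: "n \<noteq> 0 \<Longrightarrow> hd (list_decode n) = fst (prod_decode (n - 1))"
  by (cases n) (auto split: prod.split)

lemma tl_list_decode: "list_encode (tl (list_decode n)) = snd (prod_decode (n - 1))"
proof (cases n)
  case 0
  have "prod_decode 0 = (0, 0)"
    using prod_encode_inverse[of "(0, 0)"] by (simp add: prod_encode_def)
  then show ?thesis using 0 by simp
next
  case (Suc m)
  then show ?thesis by (simp split: prod.split)
qed

lemma recursive_drop:
  assumes "recursive k N" "recursive k F"
  shows "recursive k (\<lambda>xs. list_encode (drop (N xs) (list_decode (F xs))))"
proof -
  have "recursive 4 (\<lambda>xs. snd (prod_decode (xs ! 1 - 1)))"
    by (intro recursive_pairing recursive_pred recursive_proj) simp
  then have "recursive k (\<lambda>xs. rec_nat (F xs) (\<lambda>n y. snd (prod_decode (y - 1))) (N xs))"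
    using recursive_rec[of "\<lambda>a _. a" "\<lambda>_ y _ _. snd (prod_decode (y - 1))", OF _ _ assms recursive_const]
    by (simp add: recursive_proj)
  moreover have "rec_nat a (\<lambda>n y. snd (prod_decode (y - 1))) i = list_encode (drop i (list_decode a))"
    for a i
    by (induction i) (simp_all flip: tl_list_decode tl_drop add: drop_Suc del: One_nat_def)
  ultimately show ?thesis by simp
qed

lemma length_le_list_encode: "length xs \<le> list_encode xs"
  by (induction xs) (auto intro: order.trans le_prod_encode_2)

text \<open>The list is scanned \<open>n\<close> times when \<open>n\<close> is its code, which bounds its length; the accumulator
  does not change once the list is exhausted.\<close>

lemma recursive_rev_append:
  assumes "recursive k F" "recursive k G"
  shows "recursive k (\<lambda>xs. list_encode (rev (list_decode (F xs)) @ list_decode (G xs)))"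
proof -
  define d where "d i n = list_encode (drop i (list_decode n))" for i n
  define g where "g i y n = (if d i n = 0 then y
    else list_encode (fst (prod_decode (d i n - 1)) # list_decode y))" for i y n
  have "recursive 4 (\<lambda>xs. g (xs ! 0) (xs ! 1) (xs ! 2))"
    unfolding g_def d_def
    by (intro recursive_if recursive_drop recursive_Cons recursive_hd recursive_proj) simp_all
  then have "recursive k (\<lambda>xs. rec_nat (G xs) (\<lambda>i y. g i y (F xs)) (F xs))"
    using recursive_rec[of "\<lambda>_ b. b" "\<lambda>i y n _. g i y n", OF _ _ assms(1) assms]
    by (simp add: recursive_proj)
  moreover have "rec_nat b (\<lambda>i y. g i y n) n = list_encode (rev (list_decode n) @ list_decode b)" for n b
  proof -
    have "rec_nat b (\<lambda>i y. g i y n) i = list_encode (rev (take i (list_decode n)) @ list_decode b)" for i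
    proof (induction i)
      case (Suc i)
      show ?case
      proof (cases "i < length (list_decode n)")
        case True
        then have "d i n \<noteq> 0" by (simp add: d_def list_encode_eq_0)
        moreover have "fst (prod_decode (d i n - 1)) = list_decode n ! i"
          using hd_list_decode[OF \<open>d i n \<noteq> 0\<close>] True by (simp add: d_def hd_drop_conv_nth)
        ultimately show ?thesis
          using True Suc by (simp add: g_def take_Suc_conv_app_nth del: list_encode.simps)
      next
        case False
        then show ?thesis using Suc by (simp add: g_def d_def)
      qed
    qed simp
    moreover have "length (list_decode n) \<le> n"
      using length_le_list_encode[of "list_decode n"] by simp
    ultimately show ?thesis by simp
  qed
  ultimately show ?thesis by simp
qed

text \<open>Two reversals make an append, the first one onto the empty list, whose code is \<open>0\<close>.\<close>

lemma recursive_append: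
  assumes "recursive k F" "recursive k G"
  shows "recursive k (\<lambda>xs. list_encode (list_decode (F xs) @ list_decode (G xs)))"
  using recursive_rev_append[OF recursive_rev_append[OF assms(1) recursive_const[of k 0]] assms(2)]
  by simp

text \<open>The coding of the letters that comes with the decision procedure for \<open>L\<close> is also used for
  \<open>L'\<close>, so the reduction only has to append and prepend constant words.\<close>

lemma decidable_words_reduction:
  assumes dec: "decidable_words X 2 L" and "Y \<subseteq> X"
    and fixed: "p \<in> lists X" "q \<in> lists X" "p' \<in> lists X" "q' \<in> lists X"
    and L': "\<And>w. w \<in> lists Y \<Longrightarrow> [w] \<in> L' \<longleftrightarrow> [p @ w @ q, p' @ w @ q'] \<in> L"
  shows "decidable_words Y 1 L'"
proof -
  from dec obtain code f where X: "finite X" and code: "inj_on code X"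
    and f: "\<And>us. length us = 2 \<Longrightarrow> set us \<subseteq> lists X \<Longrightarrow>
        computes f (map (\<lambda>u. list_encode (map code u)) us) (if us \<in> L then 1 else 0)"
    unfolding decidable_words_def by blast
  define surround where "surround u v n = list_encode (list_decode (list_encode (map code u)) @
    list_decode (list_encode (list_decode n @ list_decode (list_encode (map code v)))))" for u v n
  have "recursive 1 (\<lambda>xs. surround u v (xs ! 0))" for u v
    unfolding surround_def by (intro recursive_append recursive_const recursive_proj) simp
  then obtain s where s: "\<And>u v xs. length xs = 1 \<Longrightarrow> computes (s u v) xs (surround u v (xs ! 0))"
    unfolding recursive_def by metis
  have surround: "surround u v (list_encode (map code w)) = list_encode (map code (u @ w @ v))" for u v w
    by (simp add: surround_def)
  have "computes (Comp f [s p q, s p' q']) (map (\<lambda>u. list_encode (map code u)) us)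
      (if us \<in> L' then 1 else 0)" if us: "length us = 1" "set us \<subseteq> lists Y" for us
  proof -
    from us obtain w where w: "us = [w]" "w \<in> lists Y"
      by (cases us) auto
    then have "w \<in> lists X" using \<open>Y \<subseteq> X\<close> by (auto dest: lists_mono)
    then have "computes f [list_encode (map code (p @ w @ q)), list_encode (map code (p' @ w @ q'))]
        (if us \<in> L' then 1 else 0)"
      using f[of "[p @ w @ q, p' @ w @ q']"] fixed L' w by simp
    moreover have "computes (s u v) [list_encode (map code w)] (list_encode (map code (u @ w @ v)))" for u v
      using s[of "[list_encode (map code w)]" u v] unfolding surround nth_Cons_0 by simp
    ultimately show ?thesis
      unfolding w(1)
      by (intro computes.Comp[of "[list_encode (map code (p @ w @ q)), list_encode (map code (p' @ w @ q'))]"])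
        (auto simp: less_Suc_eq simp del: map_append)
  qed
  then show ?thesis
    unfolding decidable_words_def
    using X \<open>Y \<subseteq> X\<close> code by (blast intro: finite_subset inj_on_subset)
qed

section \<open>The inverse monoid that encodes membership\<close>

text \<open>In this context \<open>K\<close> is the maximal group image of the inverse monoid \<open>M\<close>. The relators of
  \<open>K\<close> are those of \<open>G\<close> up to a word that is trivial in every group, so \<open>K\<close> is the free product of
  \<open>G\<close> with the infinite cyclic group on \<open>t\<close>.\<close>

locale membership_encoding =
  fixes as :: "'a list" and t :: 'a and r\<^sub>1 :: "'a word" and rs ws :: "'a word list"
  assumes t_notin: "t \<notin> set as"
    and relators: "set (r\<^sub>1 # rs) \<subseteq> lists (letters (set as))"
    and generators: "set ws \<subseteq> lists (letters (set as))"
begin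

abbreviation "A \<equiv> set as"
abbreviation "B \<equiv> insert t A"

definition "factors = map (\<lambda>a. [Pos a]) as @ map (\<lambda>w. [Pos t] @ w @ [Neg t]) ws @ map (\<lambda>a. [Neg a]) as"

definition "R\<^sub>G = {(r, []) | r. r \<in> set (r\<^sub>1 # rs)}"
definition "R\<^sub>M = {(idem_word factors @ r\<^sub>1, [])} \<union> {(r, []) | r. r \<in> set rs}"

abbreviation "G \<equiv> Gp A R\<^sub>G"
abbreviation "cl\<^sub>G \<equiv> gp_class A R\<^sub>G"
abbreviation "cl\<^sub>K \<equiv> gp_class B R\<^sub>M"
abbreviation "cl\<^sub>M \<equiv> inv_class B R\<^sub>M"
abbreviation "T \<equiv> generated_submonoid G {cl\<^sub>G w | w. w \<in> set ws}"

sublocale G: group G by (rule group_Gp)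

sublocale M: wagner_quotient cl\<^sub>M by (rule wagner_inv_class)

lemma lists_A_B: "w \<in> lists (letters A) \<Longrightarrow> w \<in> lists (letters B)"
  by (rule subsetD[OF lists_mono]) (auto simp: letters_def)

lemma t_letters: "Pos t \<in> letters B" "Neg t \<in> letters B"
  by (auto simp: letters_def)

lemma factors_lists: "set factors \<subseteq> lists (letters B)"
proof -
  have "[Pos t] @ w @ [Neg t] \<in> lists (letters B)" if "w \<in> set ws" for w
    using that generators lists_A_B[of w] t_letters by auto
  moreover have "[Pos a] \<in> lists (letters B)" "[Neg a] \<in> lists (letters B)" if "a \<in> A" for a
    using that by (auto simp: letters_def)
  ultimately show ?thesis unfolding factors_def by auto
qed

lemma idem_word_lists: "set us \<subseteq> lists (letters C) \<Longrightarrow> idem_word us \<in> lists (letters C)"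
  by (induction us) auto


subsection \<open>The maximal group image acts on reduced forms\<close>

sublocale stack_machine G A t "\<lambda>x. cl\<^sub>G [x]"
proof
  fix x assume x: "x \<in> letters A"
  then show "cl\<^sub>G [x] \<in> carrier G" by (simp add: gp_class_carrier)
  have "cl\<^sub>G [letter_inv x] \<otimes>\<^bsub>G\<^esub> cl\<^sub>G [x] = \<one>\<^bsub>G\<^esub>"
    using x gp_class_inverse[of "[letter_inv x]" A R\<^sub>G] by (simp add: Gp_mult Gp_one)
  then show "cl\<^sub>G [letter_inv x] = inv\<^bsub>G\<^esub> (cl\<^sub>G [x])"
    using x by (intro G.inv_equality[symmetric]) (simp_all add: gp_class_carrier)
qed (rule t_notin)

lemma run_A_word:
  assumes "u \<in> lists (letters A)" "C \<in> carrier G"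
  shows "run (C, stk) u = (C \<otimes>\<^bsub>G\<^esub> cl\<^sub>G u, stk)"
  using assms
proof (induction u arbitrary: C)
  case Nil
  then show ?case by (simp flip: Gp_one)
next
  case (Cons x u)
  then have "x \<notin> letters {t}" using t_notin by (auto simp: letters_def)
  with Cons show ?case
    using Gp_mult[of "[x]" A u R\<^sub>G] by (simp add: gp_class_carrier G.m_assoc)
qed

lemma run_relator:
  assumes "r \<in> set (r\<^sub>1 # rs)" "reduced s"
  shows "run s r = s"
proof (cases s)
  case (Pair C stk)
  have r: "r \<in> lists (letters A)" using assms(1) relators by auto
  then have "cl\<^sub>G r = \<one>\<^bsub>G\<^esub>"
    using assms(1) unfolding Gp_one by (intro gp_class_relator) (auto simp: R\<^sub>G_def)
  then show ?thesis
    using Pair r assms(2) reduced_carrier[of C stk] by (simp add: run_A_word)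
qed

text \<open>Equality in \<open>K\<close> implies equal action on reduced states. The action is restricted to those
  states, as only there inverse letters cancel.\<close>

lemma run_gp_cong:
  assumes "(u, v) \<in> gp_cong B R\<^sub>M" "reduced s"
  shows "run s u = run s v"
proof -
  have "restrict (\<lambda>s. run s u) {s. reduced s} = restrict (\<lambda>s. run s v) {s. reduced s}"
  proof (rule congruence_respects[OF assms(1)[unfolded gp_cong_def], where f = "\<lambda>w. restrict (\<lambda>s. run s w) {s. reduced s}"])
    fix u v :: "'a word"
    assume "(u, v) \<in> {([x, letter_inv x], []) | x. x \<in> letters B} \<union> R\<^sub>M"
    then consider x where "x \<in> letters B" "u = [x] @ word_inv [x]" "v = []"
      | "u = idem_word factors @ r\<^sub>1" "v = []" | "u \<in> set rs" "v = []"
      unfolding R\<^sub>M_def by auto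
    then have "run s u = run s v" if "reduced s" for s
    proof cases
      case 1
      then show ?thesis using run_word_inv[OF that, of "[x]"] by simp
    next
      case 2
      then show ?thesis using run_idem_word[OF that factors_lists] run_relator[OF _ that] by simp
    next
      case 3
      then show ?thesis using run_relator[OF _ that] by simp
    qed
    then show "restrict (\<lambda>s. run s u) {s. reduced s} = restrict (\<lambda>s. run s v) {s. reduced s}"
      by (intro restrict_ext) simp
  next
    fix u u' v v' :: "'a word"
    assume lists: "u \<in> lists (letters B)" "u' \<in> lists (letters B)"
      and u: "restrict (\<lambda>s. run s u) {s. reduced s} = restrict (\<lambda>s. run s u') {s. reduced s}"
      and v: "restrict (\<lambda>s. run s v) {s. reduced s} = restrict (\<lambda>s. run s v') {s. reduced s}"
    have eq: "run s u = run s u'" "run s v = run s v'" if "reduced s" for s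
      using fun_cong[OF u, of s] fun_cong[OF v, of s] that by simp_all
    have "run s (u @ v) = run s (u' @ v')" if "reduced s" for s
      using eq(1)[OF that] eq(2)[OF reduced_run[OF that lists(2)]] by simp
    then show "restrict (\<lambda>s. run s (u @ v)) {s. reduced s} = restrict (\<lambda>s. run s (u' @ v')) {s. reduced s}"
      by (intro restrict_ext) simp
  qed
  from fun_cong[OF this, of s] show ?thesis using assms(2) by simp
qed


subsection \<open>Consequences of the relations\<close>

text \<open>The relation \<open>e r\<^sub>1 = 1\<close> makes the idempotent \<open>e\<close> right invertible, hence trivial, together
  with all its factors. In this way a single relation says that the letters of \<open>A\<close> are units and
  that the words \<open>t w\<^sub>j t\<inverse>\<close> are right invertible.\<close>

lemma factor_right_invertible:
  assumes "u \<in> set factors"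
  shows "cl\<^sub>M (u @ word_inv u) = cl\<^sub>M []"
proof (rule M.idem_word_trivial_factor[OF M.idem_word_right_invertible assms])
  have "idem_word factors @ r\<^sub>1 \<in> lists (letters B)"
    using idem_word_lists[OF factors_lists] lists_A_B[of r\<^sub>1] relators by simp
  then show "cl\<^sub>M (idem_word factors @ r\<^sub>1) = cl\<^sub>M []"
    by (intro inv_class_relator) (auto simp: R\<^sub>M_def)
qed

lemma relator_trivial:
  assumes "r \<in> set (r\<^sub>1 # rs)"
  shows "cl\<^sub>M r = cl\<^sub>M []"
proof (cases "r \<in> set rs")
  case True
  then show ?thesis
    using relators lists_A_B[of r] by (intro inv_class_relator) (auto simp: R\<^sub>M_def)
next
  case False
  then have "r = r\<^sub>1" using assms by simp
  have rel: "cl\<^sub>M (idem_word factors @ r\<^sub>1) = cl\<^sub>M []"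
    using idem_word_lists[OF factors_lists] lists_A_B[of r\<^sub>1] relators
    by (intro inv_class_relator) (auto simp: R\<^sub>M_def)
  then show ?thesis
    using M.subst_word_nil[OF M.idem_word_right_invertible[OF rel], of "[]" r\<^sub>1] \<open>r = r\<^sub>1\<close> by simp
qed

lemma letter_unit:
  assumes "x \<in> letters A"
  shows "cl\<^sub>M [x, letter_inv x] = cl\<^sub>M []"
proof -
  have "[x] \<in> set factors" using assms by (auto simp: letters_def factors_def)
  from factor_right_invertible[OF this] show ?thesis by simp
qed

text \<open>The letters of \<open>A\<close> are units that satisfy the relations of \<open>G\<close>, so there is a
  homomorphism from \<open>G\<close> to \<open>M\<close>.\<close>

lemma gp_cong_cl\<^sub>M:
  assumes "(u, v) \<in> gp_cong A R\<^sub>G"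
  shows "cl\<^sub>M u = cl\<^sub>M v"
  using assms unfolding gp_cong_def
proof (rule congruence_respects)
  fix u v :: "'a word"
  assume "(u, v) \<in> {([x, letter_inv x], []) | x. x \<in> letters A} \<union> R\<^sub>G"
  then show "cl\<^sub>M u = cl\<^sub>M v" using letter_unit relator_trivial by (auto simp: R\<^sub>G_def)
qed (rule M.append)

lemma cl\<^sub>G_cl\<^sub>M:
  assumes "cl\<^sub>G u = cl\<^sub>G v" "u \<in> lists (letters A)" "v \<in> lists (letters A)"
  shows "cl\<^sub>M u = cl\<^sub>M v"
proof -
  have "v \<in> cl\<^sub>G u" using assms by (simp add: gp_cong_iff)
  then show ?thesis by (intro gp_cong_cl\<^sub>M) simp
qed


subsection \<open>E-unitarity\<close>

text \<open>A state is spelled by every word obtained from its product form by choosing words for the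
  group elements. The choice is immaterial in \<open>M\<close> because \<open>G\<close> maps to \<open>M\<close>.\<close>

fun spells :: "'a word \<Rightarrow> 'a word set \<times> ('a letter \<times> 'a word set) list \<Rightarrow> bool" where
  "spells v (C, []) \<longleftrightarrow> v \<in> C"
| "spells v (C, (y, D) # stk) \<longleftrightarrow> (\<exists>v' u. v = v' @ [y] @ u \<and> u \<in> C \<and> spells v' (D, stk))"

lemma spells_append:
  assumes "spells v (C, stk)" "\<And>u. u \<in> C \<Longrightarrow> u @ w \<in> C'"
  shows "spells (v @ w) (C', stk)"
  using assms by (cases stk) (fastforce, force)

text \<open>Running the machine imitates a right multiplication in \<open>M\<close>. The two agree except at a pop,
  where an inverse pair \<open>t t\<inverse>\<close> or \<open>t\<inverse> t\<close> is deleted; such a pair is an idempotent of \<open>M\<close>, so its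
  deletion can only go up in the natural order.\<close>

lemma step_below:
  assumes s: "reduced s" "spells v s" and x: "x \<in> letters B"
  shows "\<exists>v'. spells v' (step s x) \<and> M.below (v @ [x]) v'"
proof (cases s)
  case (Pair C stk)
  from x show ?thesis
  proof (cases rule: letters_insert_cases)
    case 1
    show ?thesis
    proof (cases "stk \<noteq> [] \<and> C = \<one>\<^bsub>G\<^esub> \<and> fst (hd stk) = letter_inv x")
      (* A pop: the group element between the two powers of t is trivial, so their inverse
         pair is adjacent in M and can be deleted. *)
      case True
      then obtain D stk' where stk: "stk = (letter_inv x, D) # stk'"
        by (cases stk) auto
      with s Pair obtain v' u where v: "v = v' @ [letter_inv x] @ u" "u \<in> C" "spells v' (D, stk')"
        by auto
      have "u \<in> cl\<^sub>G []" using v(2) True by (simp add: Gp_one)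
      then have "cl\<^sub>M u = cl\<^sub>M []" by (intro gp_cong_cl\<^sub>M[symmetric]) simp
      then have "cl\<^sub>M (v @ [x]) = cl\<^sub>M (v' @ [letter_inv x] @ word_inv [letter_inv x])"
        using M.subst_word_nil[of u "v' @ [letter_inv x]" "[x]"] v(1) by simp
      then have "M.below (v @ [x]) v'"
        using M.below_trans[OF M.below_eq M.below_delete_inverse_pair] by blast
      moreover have "step s x = (D, stk')" using Pair True 1 stk by simp
      ultimately show ?thesis using v(3) by auto
    next
      case False
      have "[] \<in> cl\<^sub>G []" by (simp add: gp_cong_iff)
      then have "spells (v @ [x]) (step s x)"
        using False Pair 1 s(2) by (auto simp: Gp_one)
      then show ?thesis using M.below_eq by blast
    qed
  next
    case 2
    have "C \<in> carrier G" using s(1) Pair reduced_carrier by blast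
    then obtain c where c: "c \<in> lists (letters A)" "C = cl\<^sub>G c" unfolding Gp_carrier by blast
    have "u @ [x] \<in> cl\<^sub>G (c @ [x])" if "u \<in> C" for u
      using that c 2 gp_class_append[of A R\<^sub>G u c "[x]" "[x]"] by (simp add: gp_cong_iff)
    moreover have "step s x = (cl\<^sub>G (c @ [x]), stk)"
      using Pair 2 c by (simp add: Gp_mult)
    ultimately have "spells (v @ [x]) (step s x)"
      using s(2) Pair spells_append[of v C stk "[x]"] by simp
    then show ?thesis using M.below_eq by blast
  qed
qed

lemma run_below:
  assumes "w \<in> lists (letters B)" "reduced s" "spells v s"
  shows "\<exists>v'. spells v' (run s w) \<and> M.below (v @ w) v'"
  using assms
proof (induction w arbitrary: s v)
  case Nil
  then show ?case using M.below_eq[OF HOL.refl, of v] by auto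
next
  case (Cons x w)
  then obtain v1 where v1: "spells v1 (step s x)" "M.below (v @ [x]) v1"
    using step_below[of s v x] by auto
  obtain v2 where v2: "spells v2 (run (step s x) w)" "M.below (v1 @ w) v2"
    using Cons.IH[OF reduced_step[of s x] v1(1)] Cons by auto
  have "M.below (v @ x # w) v2"
    using M.below_trans[OF M.below_append[OF v1(2), of w] v2(2)] by simp
  with v2(1) show ?case by (auto simp del: step.simps)
qed

text \<open>A word that is trivial in \<open>K\<close> brings the machine back to the initial state, so it lies below
  the identity of \<open>M\<close>.\<close>

theorem E_unitary_M: "E_unitary B R\<^sub>M"
proof (rule E_unitaryI)
  fix w assume w: "w \<in> lists (letters B)" "cl\<^sub>K w = cl\<^sub>K []"
  let ?s = "(cl\<^sub>G [], [])"
  have s: "reduced ?s" "spells [] ?s"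
    by (simp_all add: gp_class_carrier gp_cong_iff)
  obtain v where v: "spells v (run ?s w)" "M.below w v"
    using run_below[OF w(1) s] by auto
  have "w \<in> cl\<^sub>K []" using w by (simp add: gp_cong_iff)
  then have "run ?s w = ?s"
    using run_gp_cong[of "[]" w ?s] s(1) by simp
  with v(1) have "cl\<^sub>M v = cl\<^sub>M []"
    by (intro gp_cong_cl\<^sub>M[symmetric]) simp
  then have "M.below w []"
    using M.below_trans[OF v(2) M.below_eq] by blast
  then show "cl\<^sub>M (w @ w) = cl\<^sub>M w" by (rule M.below_empty_idempotent)
qed


subsection \<open>Membership expressed in the inverse monoid\<close>

lemma S_carrier: "{cl\<^sub>G w | w. w \<in> set ws} \<subseteq> carrier G"
  using generators by (auto intro: gp_class_carrier)

lemma submonoid_T: "submonoid T G"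
  by (rule submonoid_generated[OF G.monoid_axioms S_carrier])

text \<open>The test for membership is the equation \<open>t w t\<inverse> t = t w\<close>. With \<open>p = t\<inverse> t\<close> it says that
  \<open>p w p = p w\<close>, that is, \<open>w\<close> maps the range of \<open>t\<close> into itself. For a generator, right
  invertibility of \<open>t w t\<inverse>\<close> gives \<open>t (w p w\<inverse>) = t\<close>, because the idempotents \<open>w p w\<inverse>\<close> and \<open>p\<close>
  commute.\<close>

lemma generator_absorbs:
  assumes "w \<in> set ws"
  shows "cl\<^sub>M ([Pos t] @ w @ [Neg t, Pos t]) = cl\<^sub>M ([Pos t] @ w)"
proof -
  let ?t = "[Pos t]" and ?t' = "[Neg t]" and ?w' = "word_inv w"
  have "[Pos t] @ w @ [Neg t] \<in> set factors" using assms by (auto simp: factors_def)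
  from factor_right_invertible[OF this]
  have right_inv: "cl\<^sub>M (?t @ w @ ?t' @ ?t @ ?w' @ ?t') = cl\<^sub>M []" by simp
  have w: "w \<in> lists (letters A)" using assms generators by auto
  have unit: "cl\<^sub>M (?w' @ w) = cl\<^sub>M []"
    using w gp_class_inverse[of ?w' A R\<^sub>G] by (intro cl\<^sub>G_cl\<^sub>M) simp_all
  have "cl\<^sub>M ?t = cl\<^sub>M (?t @ (w @ ?t') @ word_inv (w @ ?t') @ ?t' @ word_inv ?t')"
    using M.subst_word_nil[OF right_inv, of "[]" ?t] by simp
  also have "\<dots> = cl\<^sub>M (?t @ ?t' @ word_inv ?t' @ (w @ ?t') @ word_inv (w @ ?t'))"
    using M.subst_word[OF M.commute[of "w @ ?t'" ?t'], of ?t "[]"] by simp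
  also have "\<dots> = cl\<^sub>M (?t @ w @ ?t' @ ?t @ ?w')"
    using M.subst_word[OF M.regular[of ?t], of "[]" "w @ ?t' @ ?t @ ?w'"] by simp
  finally have "cl\<^sub>M (?t @ w) = cl\<^sub>M (?t @ w @ ?t' @ ?t @ ?w' @ w)"
    using M.subst_word[of ?t "?t @ w @ ?t' @ ?t @ ?w'" "[]" w] by simp
  then show ?thesis
    using M.subst_word_nil[OF unit, of "?t @ w @ ?t' @ ?t" "[]"] by simp
qed

text \<open>Words that pass the test are closed under products, as are the maps that send a given set into
  itself.\<close>

lemma T_absorbs:
  assumes "w \<in> lists (letters A)" "cl\<^sub>G w \<in> T"
  shows "cl\<^sub>M ([Pos t] @ w @ [Neg t, Pos t]) = cl\<^sub>M ([Pos t] @ w)"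
proof -
  define H where "H = {cl\<^sub>G u | u. u \<in> lists (letters A) \<and>
    cl\<^sub>M ([Pos t] @ u @ [Neg t, Pos t]) = cl\<^sub>M ([Pos t] @ u)}"
  have "submonoid H G"
  proof
    show "H \<subseteq> carrier G" by (auto simp: H_def intro: gp_class_carrier)
    have "cl\<^sub>M ([Pos t] @ [] @ [Neg t, Pos t]) = cl\<^sub>M ([Pos t] @ [])"
      using M.regular[of "[Pos t]"] by simp
    then show "\<one>\<^bsub>G\<^esub> \<in> H" unfolding H_def Gp_one mem_Collect_eq
      by (intro exI[of _ "[]"]) simp
  next
    fix C D assume "C \<in> H" "D \<in> H"
    then obtain u v where u: "C = cl\<^sub>G u" "u \<in> lists (letters A)"
        "cl\<^sub>M ([Pos t] @ u @ [Neg t, Pos t]) = cl\<^sub>M ([Pos t] @ u)"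
      and v: "D = cl\<^sub>G v" "v \<in> lists (letters A)"
        "cl\<^sub>M ([Pos t] @ v @ [Neg t, Pos t]) = cl\<^sub>M ([Pos t] @ v)"
      unfolding H_def by blast
    have "cl\<^sub>M ([Pos t] @ (u @ v) @ [Neg t, Pos t]) = cl\<^sub>M ([Pos t] @ u @ [Neg t, Pos t] @ v @ [Neg t, Pos t])"
      using M.subst_word[OF u(3), of "[]" "v @ [Neg t, Pos t]"] by simp
    also have "\<dots> = cl\<^sub>M ([Pos t] @ u @ [Neg t, Pos t] @ v)"
      using M.subst_word[OF v(3), of "[Pos t] @ u @ [Neg t]" "[]"] by simp
    also have "\<dots> = cl\<^sub>M ([Pos t] @ u @ v)"
      using M.subst_word[OF u(3), of "[]" v] by simp
    finally show "C \<otimes>\<^bsub>G\<^esub> D \<in> H"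
      unfolding H_def mem_Collect_eq using u v by (intro exI[of _ "u @ v"]) (simp add: Gp_mult)
  qed
  moreover have "{cl\<^sub>G w | w. w \<in> set ws} \<subseteq> H"
    unfolding H_def using generators generator_absorbs by blast
  ultimately have "cl\<^sub>G w \<in> H" using assms(2) generated_submonoid_least by blast
  then obtain u where u: "u \<in> lists (letters A)" "cl\<^sub>G w = cl\<^sub>G u"
      "cl\<^sub>M ([Pos t] @ u @ [Neg t, Pos t]) = cl\<^sub>M ([Pos t] @ u)"
    unfolding H_def by blast
  have wu: "cl\<^sub>M w = cl\<^sub>M u" by (rule cl\<^sub>G_cl\<^sub>M) (use u assms in auto)
  show ?thesis
    using M.subst_word[OF wu, of "[Pos t]" "[Neg t, Pos t]"] M.subst_word[OF wu, of "[Pos t]" "[]"] u(3)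
    by simp
qed

text \<open>Right multiplication on infinitely many copies of the group. The copies make the set infinite
  even if the group is finite.\<close>

definition shift :: "'a word set \<Rightarrow> (('a word set \<times> nat) \<times> ('a word set \<times> nat)) set" where
  "shift D = {((C, n), (C \<otimes>\<^bsub>G\<^esub> D, n)) | C n. C \<in> carrier G}"

lemma shift_one: "shift \<one>\<^bsub>G\<^esub> = Id_on (carrier G \<times> UNIV)"
  by (auto simp: shift_def)

lemma shift_mult:
  assumes "D \<in> carrier G" "E \<in> carrier G"
  shows "shift D O shift E = shift (D \<otimes>\<^bsub>G\<^esub> E)"
proof -
  have "((C, n), (C \<otimes>\<^bsub>G\<^esub> (D \<otimes>\<^bsub>G\<^esub> E), n)) \<in> shift D O shift E" if "C \<in> carrier G" for C n
    using that assms unfolding shift_def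
    by (intro relcompI[of _ "(C \<otimes>\<^bsub>G\<^esub> D, n)"]) (auto simp: G.m_assoc)
  moreover have "shift D O shift E \<subseteq> shift (D \<otimes>\<^bsub>G\<^esub> E)"
    using assms by (auto simp: shift_def G.m_assoc)
  ultimately show ?thesis by (fastforce simp: shift_def)
qed

lemma shift_inverse:
  assumes "D \<in> carrier G"
  shows "(shift D)\<inverse> = shift (inv\<^bsub>G\<^esub> D)"
proof -
  have "((C \<otimes>\<^bsub>G\<^esub> D, n), (C, n)) \<in> shift (inv\<^bsub>G\<^esub> D)" if "C \<in> carrier G" for C n
    using that assms by (auto simp: shift_def G.m_assoc)
  moreover have "((C \<otimes>\<^bsub>G\<^esub> inv\<^bsub>G\<^esub> D, n), (C, n)) \<in> shift D" if "C \<in> carrier G" for C n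
    using that assms by (auto simp: shift_def G.m_assoc)
  ultimately show ?thesis by (fastforce simp: shift_def)
qed

lemma shift_single_valued: "single_valued (shift D)"
  by (simp add: shift_def single_valued_def)

text \<open>Both sets are countably infinite, as \<open>A\<close> is finite and \<open>T\<close> contains the identity.\<close>

lemma bijection_onto_T: "\<exists>h. bij_betw h (carrier G \<times> (UNIV :: nat set)) (T \<times> (UNIV :: nat set))"
proof -
  interpret T: submonoid T G by (rule submonoid_T)
  have "carrier G \<subseteq> cl\<^sub>G ` lists (letters A)"
    using Gp_carrier[of _ A R\<^sub>G] by blast
  moreover have "countable (lists (letters A))"
    by (auto simp: letters_def intro: countable_finite)
  ultimately have "countable (carrier G)"
    by (meson countable_image countable_subset)
  then have "countable (carrier G \<times> (UNIV :: nat set))" "countable (T \<times> (UNIV :: nat set))"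
    using countable_subset[OF T.subset] by auto
  moreover have "infinite (carrier G \<times> (UNIV :: nat set))" "infinite (T \<times> (UNIV :: nat set))"
    using T.one_closed G.one_closed by (auto simp: finite_cartesian_product_iff simp del: T.one_closed)
  ultimately show ?thesis
    using bij_betw_trans[OF to_nat_on_infinite bij_betw_inv_into[OF to_nat_on_infinite]] by blast
qed

text \<open>A representation of \<open>M\<close> shows that only elements of \<open>T\<close> pass the test. The group acts on
  countably many copies of itself by right multiplication, and \<open>t\<close> acts as a total injection
  onto the copies of \<open>T\<close>. Since \<open>T w\<^sub>j\<close> is contained in \<open>T\<close>, the words \<open>t w\<^sub>j t\<inverse>\<close> act as total
  maps and the relations of \<open>M\<close> hold. If \<open>w\<close> passes the test, then it maps \<open>T\<close> into \<open>T\<close>, and in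
  particular it takes the identity to an element of \<open>T\<close>.\<close>

lemma absorbs_imp_T:
  assumes w: "w \<in> lists (letters A)"
    and absorbs: "cl\<^sub>M ([Pos t] @ w @ [Neg t, Pos t]) = cl\<^sub>M ([Pos t] @ w)"
  shows "cl\<^sub>G w \<in> T"
proof -
  interpret T: submonoid T G by (rule submonoid_T)
  define X where "X = carrier G \<times> (UNIV :: nat set)"
  define Y where "Y = T \<times> (UNIV :: nat set)"
  obtain h where h: "bij_betw h X Y"
    using bijection_onto_T unfolding X_def Y_def by blast
  have YX: "Y \<subseteq> X" using T.subset by (auto simp: X_def Y_def)
  have hX: "h ` X = Y" and inj: "inj_on h X" using h by (auto simp: bij_betw_def)
  (* The relation of a letter outside the alphabet only has to be a partial injection. *)
  define \<rho>0 where "\<rho>0 a = (if a = t then {(x, h x) | x. x \<in> X} else if a \<in> A then shift (cl\<^sub>G [Pos a]) else {})" for a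
  define \<rho> where "\<rho> x = (case x of Pos a \<Rightarrow> \<rho>0 a | Neg a \<Rightarrow> (\<rho>0 a)\<inverse>)" for x
  have cl_carrier: "cl\<^sub>G [Pos a] \<in> carrier G" if "a \<in> A" for a
    using that by (intro gp_class_carrier) (auto simp: letters_def)
  have \<rho>0_subset: "\<rho>0 a \<subseteq> X \<times> X" for a
    using YX hX cl_carrier by (auto simp: \<rho>0_def shift_def X_def)
  have \<rho>0_injective: "single_valued (\<rho>0 a) \<and> single_valued ((\<rho>0 a)\<inverse>)" for a
  proof -
    consider "\<rho>0 a = {(x, h x) | x. x \<in> X}" | "a \<in> A" "\<rho>0 a = shift (cl\<^sub>G [Pos a])" | "\<rho>0 a = {}"
      by (cases "a = t"; cases "a \<in> A") (simp_all add: \<rho>0_def)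
    then show ?thesis
    proof cases
      case 1
      then show ?thesis
        using inj by (auto simp: single_valued_def simp del: split_paired_Ex split_paired_All dest: inj_onD)
    next
      case 2
      then show ?thesis
        using shift_inverse[OF cl_carrier] shift_single_valued by simp
    qed simp
  qed
  interpret partial_injections X \<rho>
  proof
    fix x :: "'a letter"
    show "\<rho> x \<subseteq> X \<times> X" using \<rho>0_subset by (cases x) (auto simp: \<rho>_def)
    show "single_valued (\<rho> x)" using \<rho>0_injective by (cases x) (auto simp: \<rho>_def)
    show "\<rho> (letter_inv x) = (\<rho> x)\<inverse>" by (cases x) (auto simp: \<rho>_def)
  qed
  have \<rho>_t: "\<rho> (Pos t) = {(x, h x) | x. x \<in> X}" "\<rho> (Neg t) = {(h x, x) | x. x \<in> X}"
    by (auto simp: \<rho>_def \<rho>0_def)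
  have \<rho>_A: "\<rho> x = shift (cl\<^sub>G [x])" if "x \<in> letters A" for x
  proof (cases x)
    case (Pos a)
    then show ?thesis using that t_notin by (auto simp: \<rho>_def \<rho>0_def letters_def)
  next
    case (Neg a)
    then have a: "a \<in> A" "Pos a \<in> letters A" using that by (auto simp: letters_def)
    have "\<rho> x = (shift (cl\<^sub>G [Pos a]))\<inverse>"
      using a Neg t_notin by (auto simp: \<rho>_def \<rho>0_def)
    also have "\<dots> = shift (cl\<^sub>G [x])"
      using shift_inverse[OF cl_carrier[OF a(1)]] \<gamma>_inv[OF a(2)] Neg by simp
    finally show ?thesis .
  qed
  have shift_X: "shift \<one>\<^bsub>G\<^esub> = Id_on X" using shift_one by (simp add: X_def)
  have act_A: "act u = shift (cl\<^sub>G u)" if "u \<in> lists (letters A)" for u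
    using that
  proof (induction u)
    case Nil
    then show ?case using shift_X by (simp add: Gp_one)
  next
    case (Cons x u)
    then show ?case
      using Gp_mult[of "[x]" A u R\<^sub>G] by (simp add: \<rho>_A shift_mult gp_class_carrier)
  qed
  have total: "Domain (act u) = X" if "u \<in> set factors" for u
  proof -
    from that consider x where "x \<in> letters A" "u = [x]"
      | v where "v \<in> set ws" "u = [Pos t] @ v @ [Neg t]"
      by (auto simp: letters_def factors_def)
    then show ?thesis
    proof cases
      case 1
      then show ?thesis
        using act_A[of u] by (auto simp: shift_def X_def)
    next
      case 2
      have v: "v \<in> lists (letters A)" "cl\<^sub>G v \<in> T"
        using 2(1) generators generated_submonoid_incl[of "{cl\<^sub>G w | w. w \<in> set ws}" G] by auto
      have act_u: "act u = \<rho> (Pos t) O shift (cl\<^sub>G v) O \<rho> (Neg t)"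
        using 2(2) act_append[of v "[Neg t]"] act_A[OF v(1)] act_single[of "Neg t"] by simp
      \<comment> \<open>The point \<open>h x\<close> lies in a copy of \<open>T\<close>, and so does its image under \<open>v\<close>, to which the
        inverse of \<open>h\<close> applies.\<close>
      have "x \<in> Domain (act u)" if "x \<in> X" for x
      proof -
        have "h x \<in> Y" using that hX by auto
        then obtain C n where C: "h x = (C, n)" "C \<in> T" by (auto simp: Y_def)
        then have "(C \<otimes>\<^bsub>G\<^esub> cl\<^sub>G v, n) \<in> Y" using v(2) T.m_closed by (simp add: Y_def)
        then obtain y where y: "y \<in> X" "h y = (C \<otimes>\<^bsub>G\<^esub> cl\<^sub>G v, n)" using hX by auto
        have "(x, h x) \<in> \<rho> (Pos t)" "(h y, y) \<in> \<rho> (Neg t)"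
          unfolding \<rho>_t using that y(1) by blast+
        moreover have "(h x, h y) \<in> shift (cl\<^sub>G v)"
          using C y(2) T.subset by (auto simp: shift_def)
        ultimately show ?thesis unfolding act_u by blast
      qed
      moreover have "Domain (act u) \<subseteq> X" using act_subset[of u] by auto
      ultimately show ?thesis by blast
    qed
  qed
  have act_relator: "act r = Id_on X" if "r \<in> set (r\<^sub>1 # rs)" for r
  proof -
    have r: "r \<in> lists (letters A)" using that relators by auto
    have "cl\<^sub>G r = \<one>\<^bsub>G\<^esub>" unfolding Gp_one
      using that r by (intro gp_class_relator) (auto simp: R\<^sub>G_def)
    then show ?thesis using act_A[OF r] shift_X by simp
  qed
  have act_R: "act u = act v" if "(u, v) \<in> R\<^sub>M" for u v
  proof -
    from that consider "u = idem_word factors @ r\<^sub>1" "v = []" | "u \<in> set rs" "v = []"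
      unfolding R\<^sub>M_def by auto
    then show ?thesis
    proof cases
      case 1
      then have "act u = Id_on X O Id_on X"
        using act_append[of "idem_word factors" r\<^sub>1] act_idem_word[of factors] total act_relator[of r\<^sub>1] by simp
      with 1 show ?thesis by auto
    next
      case 2
      then show ?thesis using act_relator[of u] by simp
    qed
  qed
  have lists: "[Pos t] @ w \<in> lists (letters B)" "[Pos t] @ w @ [Neg t, Pos t] \<in> lists (letters B)"
    using lists_A_B[OF w] t_letters by simp_all
  then have "([Pos t] @ w @ [Neg t, Pos t], [Pos t] @ w) \<in> inv_cong B R\<^sub>M"
    using absorbs unfolding inv_cong_def class_eq_iff by blast
  then have act_eq: "act ([Pos t] @ w @ [Neg t, Pos t]) = act ([Pos t] @ w)"
    by (rule inv_cong_act) (rule act_R)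
  \<comment> \<open>Start at the preimage under \<open>t\<close> of the identity: \<open>t w\<close> takes it to the class of \<open>w\<close>.\<close>
  have "(\<one>\<^bsub>G\<^esub>, 0) \<in> Y" using T.one_closed by (simp add: Y_def)
  then obtain x where x: "x \<in> X" "h x = (\<one>\<^bsub>G\<^esub>, 0)" using hX by auto
  have "(x, h x) \<in> \<rho> (Pos t)"
    unfolding \<rho>_t using x(1) by blast
  then have "(x, (\<one>\<^bsub>G\<^esub>, 0)) \<in> \<rho> (Pos t)" by (simp add: x(2))
  moreover have "((\<one>\<^bsub>G\<^esub>, 0), (cl\<^sub>G w, 0)) \<in> act w"
    using act_A[OF w] gp_class_carrier[OF w] G.one_closed by (force simp: shift_def)
  ultimately have "(x, (cl\<^sub>G w, 0)) \<in> act ([Pos t] @ w)" by auto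
  then have "(x, (cl\<^sub>G w, 0)) \<in> \<rho> (Pos t) O act w O \<rho> (Neg t) O \<rho> (Pos t)"
    using act_eq act_append[of w "[Neg t, Pos t]"] act_append[of "[Neg t]" "[Pos t]"]
      act_single[of "Neg t"] act_single[of "Pos t"] by simp
  then have "(cl\<^sub>G w, 0) \<in> Range (\<rho> (Pos t))" by blast
  then have "(cl\<^sub>G w, 0) \<in> Y" using hX by (auto simp: \<rho>_t)
  then show ?thesis by (simp add: Y_def)
qed

theorem decidable_membership_T:
  assumes "decidable_word_problem B R\<^sub>M"
  shows "decidable_membership A R\<^sub>G T"
  unfolding decidable_membership_def
proof (rule decidable_words_reduction[OF assms[unfolded decidable_word_problem_def]])
  show "letters A \<subseteq> letters B" by (auto simp: letters_def)
  show "[Pos t] \<in> lists (letters B)" "[Neg t, Pos t] \<in> lists (letters B)"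
    "[Pos t] \<in> lists (letters B)" "[] \<in> lists (letters B)"
    using t_letters by simp_all
  fix w assume "w \<in> lists (letters A)"
  then show "[w] \<in> {[w] | w. cl\<^sub>G w \<in> T} \<longleftrightarrow>
      [[Pos t] @ w @ [Neg t, Pos t], [Pos t] @ w @ []] \<in> {[u, v] | u v. cl\<^sub>M u = cl\<^sub>M v}"
    using T_absorbs[of w] absorbs_imp_T[of w] by auto
qed

end

theorem theorem3p8:
  fixes as :: "'a list" and t :: 'a
    and r\<^sub>1 :: "'a word" and rs :: "'a word list" and ws :: "'a word list"
  defines "A \<equiv> set as"
  defines "e \<equiv> idem_word (map (\<lambda>a. [Pos a]) as @
                 map (\<lambda>w. [Pos t] @ w @ [Neg t]) ws @ map (\<lambda>a. [Neg a]) as)"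
  defines "R\<^sub>G \<equiv> {(r, []) | r. r \<in> set (r\<^sub>1 # rs)}"
  defines "R\<^sub>M \<equiv> {(e @ r\<^sub>1, [])} \<union> {(r, []) | r. r \<in> set rs}"
  defines "G \<equiv> Gp A R\<^sub>G"
  defines "M \<equiv> Inv (insert t A) R\<^sub>M"
  defines "T \<equiv> generated_submonoid G {gp_cong A R\<^sub>G `` {w} | w. w \<in> set ws}"
  assumes "distinct as" and "t \<notin> A"
    and "set (r\<^sub>1 # rs) \<subseteq> lists (letters A)" and "set ws \<subseteq> lists (letters A)"
  shows "inverse_monoid M \<and> E_unitary (insert t A) R\<^sub>M \<and>
    (decidable_word_problem (insert t A) R\<^sub>M \<longrightarrow> decidable_membership A R\<^sub>G T)"
proof -
  interpret E: membership_encoding as t r\<^sub>1 rs ws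
    using assms(9-11) unfolding A_def by unfold_locales
  show ?thesis
    unfolding M_def T_def G_def R\<^sub>M_def R\<^sub>G_def e_def A_def
    using inverse_monoid_Inv E.E_unitary_M E.decidable_membership_T
    unfolding E.R\<^sub>M_def E.R\<^sub>G_def E.factors_def by blast
qed

end
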